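(* Let $(X,d)$ be a proper geodesic Gromov hyperbolic metric space satisfying the weak approaching geodesics property relative to a family $\mathscr{F}\subseteq\mathscr{R}(X)$ of geodesic rays. Then the map $\Psi\colon\overline{X}^G\to\overline{X}^H$ defined by $$\Psi(\xi)=\begin{cases}[d(\,\cdot\,,\xi)], & \text{if } \xi\in X,\\ [B_\gamma], & \text{if } \xi=[\gamma]\in\partial_GX,\end{cases}$$ is a homeomorphism, and thus $\overline{X}^G$ and $\overline{X}^H$ are topologically equivalent.
   Context: A geodesic is a map $\gamma\colon I\to X$ from an interval $I\subset\mathbb{R}$ with $d(\gamma(s),\gamma(t))=|t-s|$; it is a geodesic ray if $I=[0,+\infty)$. $\mathscr{R}(X)$ is the set of geodesic rays. Rays $\gamma,\sigma$ are asymptotic if $t\mapsto d(\gamma(t),\sigma(t))$ is bounded, and strongly asymptotic if there is $T\in\mathbb{R}$ with $\lim_{t\to+\infty}d(\gamma(t),\sigma(t+T))=0$. Gromov compactification: $\partial_GX$ is the set of asymptoticity classes $[\gamma]$ of geodesic rays, and $\overline{X}^G=X\sqcup\partial_GX$ with its usual compact metrizable topology. Fixing $p\in X$, a sequence $(x_n)$ in $\overline{X}^G$ converges to $\xi\in\partial_GX$ iff, choosing geodesic segments $\gamma_n$ from $p$ to $x_n$ (if $x_n\in X$) or rays from $p$ representing $x_n$ (if $x_n\in\partial_GX$), every locally uniformly convergent subsequence of $(\gamma_n)$ has limit in the class $\xi$. Horofunction compactification: let $C(X)$ be the continuous real functions on $X$ with uniform convergence on compact subsets, $C_*(X)$ its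 quotient by constants, and $[f]$ the class of $f$. $\overline{X}^H$ is the closure in $C_*(X)$ of the image of the embedding $i_H\colon x\mapsto[d(\,\cdot\,,x)]$, and $\partial_HX=\overline{X}^H\setminus i_H(X)$. Busemann function: $B_\gamma(x,y)=\lim_{t\to+\infty}\big(d(x,\gamma(t))-d(\gamma(t),y)\big)$; $[B_\gamma]\in\partial_HX$ is the class of $x\mapsto B_\gamma(x,y)$, independent of $y$. Weak approaching geodesics property relative to $\mathscr{F}\subseteq\mathscr{R}(X)$: (1) for every $p\in X$, $\xi\in\partial_GX$ and every sequence $(x_n)$ in $X$ converging to $\xi$ there exist a subsequence $(x_{n_k})$ and geodesic segments $\gamma_k$ joining $p$ to $x_{n_k}$ such that $(\gamma_k)$ converges uniformly on compact subsets to a geodesic ray in $\mathscr{F}$; (2) asymptotic geodesic rays in $\mathscr{F}$ are strongly asymptotic. Two compactifications of $X$ are topologically equivalent if there is a homeomorphism between them commuting with the embeddings of $X$. *)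

theory Defs
  imports "HOL-Analysis.Analysis"
begin

section \<open>Geodesics\<close>

text \<open>
  A map defined on an interval \<open>I\<close> is represented by a total function \<open>real \<Rightarrow> 'a\<close>; its values
  outside \<open>I\<close> are irrelevant. In particular nothing below depends on the values of a ray on
  negative reals.
\<close>

definition geodesic_on :: "real set \<Rightarrow> (real \<Rightarrow> 'a::metric_space) \<Rightarrow> bool" where
  "geodesic_on I \<gamma> \<longleftrightarrow> (\<forall>s\<in>I. \<forall>t\<in>I. dist (\<gamma> s) (\<gamma> t) = \<bar>t - s\<bar>)"

definition geodesic_ray :: "(real \<Rightarrow> 'a::metric_space) \<Rightarrow> bool" where
  "geodesic_ray \<gamma> \<longleftrightarrow> geodesic_on {0..} \<gamma>"

definition geodesic_segment :: "'a::metric_space \<Rightarrow> 'a \<Rightarrow> (real \<Rightarrow> 'a) \<Rightarrow> bool" where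
  "geodesic_segment x y \<gamma> \<longleftrightarrow>
     geodesic_on {0..dist x y} \<gamma> \<and> \<gamma> 0 = x \<and> \<gamma> (dist x y) = y"

definition asymptotic_rays :: "(real \<Rightarrow> 'a::metric_space) \<Rightarrow> (real \<Rightarrow> 'a) \<Rightarrow> bool" where
  "asymptotic_rays \<gamma> \<sigma> \<longleftrightarrow> bounded ((\<lambda>t. dist (\<gamma> t) (\<sigma> t)) ` {0..})"

definition strongly_asymptotic_rays :: "(real \<Rightarrow> 'a::metric_space) \<Rightarrow> (real \<Rightarrow> 'a) \<Rightarrow> bool" where
  "strongly_asymptotic_rays \<gamma> \<sigma> \<longleftrightarrow>
     (\<exists>T. ((\<lambda>t. dist (\<gamma> t) (\<sigma> (t + T))) \<longlongrightarrow> 0) at_top)"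

definition proper_space :: "'a::metric_space itself \<Rightarrow> bool" where
  "proper_space _ \<longleftrightarrow> (\<forall>(x::'a) r. compact (cball x r))"

definition geodesic_space :: "'a::metric_space itself \<Rightarrow> bool" where
  "geodesic_space _ \<longleftrightarrow> (\<forall>(x::'a) y. \<exists>\<gamma>. geodesic_segment x y \<gamma>)"

text \<open>
  Hyperbolicity of a geodesic space by slim triangles. It is enough to name one side, as the
  vertices (and hence the sides) are quantified universally and segments can be reversed.
\<close>

definition gromov_hyperbolic_space :: "'a::metric_space itself \<Rightarrow> bool" where
  "gromov_hyperbolic_space _ \<longleftrightarrow>
     (\<exists>\<delta>. \<forall>(x::'a) y z \<alpha> \<beta> \<gamma>.
        geodesic_segment x y \<alpha> \<and> geodesic_segment y z \<beta> \<and> geodesic_segment x z \<gamma> \<longrightarrow>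
        (\<forall>s\<in>{0..dist x y}. \<exists>q \<in> \<beta> ` {0..dist y z} \<union> \<gamma> ` {0..dist x z}. dist (\<alpha> s) q \<le> \<delta>))"


section \<open>The Gromov compactification\<close>

definition ray_class :: "(real \<Rightarrow> 'a::metric_space) \<Rightarrow> (real \<Rightarrow> 'a) set" where
  "ray_class \<gamma> = {\<sigma>. geodesic_ray \<sigma> \<and> asymptotic_rays \<gamma> \<sigma>}"

definition gromov_boundary :: "(real \<Rightarrow> 'a::metric_space) set set" where
  "gromov_boundary = ray_class ` {\<gamma>. geodesic_ray \<gamma>}"

definition gromov_carrier :: "('a::metric_space + (real \<Rightarrow> 'a) set) set" where
  "gromov_carrier = range Inl \<union> Inr ` gromov_boundary"

text \<open>
  Geodesics from \<open>p\<close> to a point of the compactification. Segments are prolonged by their end point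
  to all of \<open>{0..}\<close>, so that segments of varying length and rays have a common domain and
  locally uniform convergence makes sense for sequences of them. A limit of prolonged segments
  of bounded length is eventually constant, hence never a ray.
\<close>

fun geodesic_from_to ::
    "'a::metric_space \<Rightarrow> 'a + (real \<Rightarrow> 'a) set \<Rightarrow> (real \<Rightarrow> 'a) \<Rightarrow> bool" where
  "geodesic_from_to p (Inl x) g \<longleftrightarrow>
     (\<exists>\<gamma>. geodesic_segment p x \<gamma> \<and> (\<forall>t\<ge>0. g t = \<gamma> (min t (dist p x))))"
| "geodesic_from_to p (Inr \<xi>) g \<longleftrightarrow> g \<in> \<xi> \<and> g 0 = p"

definition locally_uniform_limit ::
    "(nat \<Rightarrow> real \<Rightarrow> 'a::metric_space) \<Rightarrow> (real \<Rightarrow> 'a) \<Rightarrow> bool" where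
  "locally_uniform_limit g h \<longleftrightarrow> (\<forall>K\<subseteq>{0..}. compact K \<longrightarrow> uniform_limit K g h sequentially)"

text \<open>
  Convergence of a sequence of the compactification to a boundary point, with base point \<open>p\<close>.
  The first conjunct only excludes vacuity of the second one; it always holds for sequences in the
  compactification of a proper geodesic hyperbolic space.
\<close>

definition gromov_converges ::
    "'a::metric_space \<Rightarrow> (nat \<Rightarrow> 'a + (real \<Rightarrow> 'a) set) \<Rightarrow> (real \<Rightarrow> 'a) set \<Rightarrow> bool" where
  "gromov_converges p x \<xi> \<longleftrightarrow>
     (\<forall>n. \<exists>g. geodesic_from_to p (x n) g) \<and>
     (\<forall>g. (\<forall>n. geodesic_from_to p (x n) (g n)) \<longrightarrow>
        (\<forall>r h. strict_mono r \<and> locally_uniform_limit (g \<circ> r) h \<longrightarrow> h \<in> \<xi>))"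

text \<open>
  A compact metrizable topology is determined by its convergent sequences, and \<open>X\<close> is open
  in the compactification with its metric topology. So the closed sets are those with closed
  trace on \<open>X\<close> that are closed under convergence of sequences to boundary points.
\<close>

definition gromov_closed :: "'a::metric_space \<Rightarrow> ('a + (real \<Rightarrow> 'a) set) set \<Rightarrow> bool" where
  "gromov_closed p C \<longleftrightarrow>
     closed (Inl -` C) \<and>
     (\<forall>x. \<forall>\<xi>\<in>gromov_boundary. range x \<subseteq> C \<and> gromov_converges p x \<xi> \<longrightarrow> Inr \<xi> \<in> C)"

definition gromov_compactification :: "'a::metric_space \<Rightarrow> ('a + (real \<Rightarrow> 'a) set) topology" where
  "gromov_compactification p =
     topology (\<lambda>U. U \<subseteq> gromov_carrier \<and> gromov_closed p (gromov_carrier - U))"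

lemma gromov_converges_subseq:
  assumes "gromov_converges p x \<xi>" "strict_mono r"
  shows "gromov_converges p (x \<circ> r) \<xi>"
proof -
  from assms(1) obtain g0 where g0: "\<And>n. geodesic_from_to p (x n) (g0 n)"
    unfolding gromov_converges_def by metis
  have "h \<in> \<xi>" if g: "\<And>n. geodesic_from_to p (x (r n)) (g n)"
    and s: "strict_mono s" and lim: "locally_uniform_limit (g \<circ> s) h" for g s h
  proof -
    define G where "G m = (if m \<in> range r then g (inv r m) else g0 m)" for m
    have inj: "inj r"
      using assms(2) by (rule strict_mono_imp_inj_on)
    have "geodesic_from_to p (x m) (G m)" for m
      using g g0 inj by (auto simp: G_def)
    moreover have "G \<circ> (r \<circ> s) = g \<circ> s"
      using inj by (auto simp: G_def)
    moreover have "strict_mono (r \<circ> s)"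
      using assms(2) s by (rule strict_mono_o)
    ultimately show ?thesis
      using assms(1) lim unfolding gromov_converges_def by metis
  qed
  with assms(1) show ?thesis
    by (auto simp: gromov_converges_def)
qed

lemma gromov_closed_Un:
  assumes "gromov_closed p C" "gromov_closed p D"
  shows "gromov_closed p (C \<union> D)"
  unfolding gromov_closed_def
proof (intro conjI allI ballI impI)
  show "closed (Inl -` (C \<union> D))"
    using assms by (auto simp: gromov_closed_def vimage_Un)
  fix x \<xi> assume \<xi>: "\<xi> \<in> gromov_boundary" and x: "range x \<subseteq> C \<union> D \<and> gromov_converges p x \<xi>"
  have "infinite {n. x n \<in> C} \<or> infinite {n. x n \<in> D}"
  proof (rule ccontr)
    assume "\<not> ?thesis"
    then have "finite ({n. x n \<in> C} \<union> {n. x n \<in> D})" by simp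
    moreover have "{n. x n \<in> C} \<union> {n. x n \<in> D} = UNIV" using x by auto
    ultimately show False by simp
  qed
  then obtain E where E: "E = C \<or> E = D" "infinite {n. x n \<in> E}" by blast
  then obtain r :: "nat \<Rightarrow> nat" where r: "strict_mono r" "\<And>n. x (r n) \<in> E"
    using infinite_enumerate[OF E(2)] by auto
  have "gromov_converges p (x \<circ> r) \<xi>"
    using gromov_converges_subseq x r(1) by blast
  moreover have "range (x \<circ> r) \<subseteq> E" "gromov_closed p E" using r E assms by auto
  ultimately have "Inr \<xi> \<in> E" using \<xi> unfolding gromov_closed_def by blast
  then show "Inr \<xi> \<in> C \<union> D" using E by auto
qed

lemma gromov_closed_INT:
  assumes "\<And>C. C \<in> \<C> \<Longrightarrow> gromov_closed p C"
  shows "gromov_closed p (\<Inter>\<C>)"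
proof -
  have "Inl -` (\<Inter>\<C>) = (\<Inter>C\<in>\<C>. Inl -` C)" by auto
  then have "closed (Inl -` (\<Inter>\<C>))"
    using assms by (auto simp: gromov_closed_def intro!: closed_INT)
  moreover have "Inr \<xi> \<in> \<Inter>\<C>"
    if "\<xi> \<in> gromov_boundary" "range x \<subseteq> \<Inter>\<C>" "gromov_converges p x \<xi>" for x \<xi>
  proof
    fix C assume "C \<in> \<C>"
    then have "gromov_closed p C" "range x \<subseteq> C" using assms that(2) by auto
    then show "Inr \<xi> \<in> C" using that(1,3) unfolding gromov_closed_def by blast
  qed
  ultimately show ?thesis unfolding gromov_closed_def by blast
qed

lemma gromov_closed_carrier: "gromov_closed p gromov_carrier"
  by (auto simp: gromov_closed_def gromov_carrier_def vimage_def)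

lemma istopology_gromov:
  "istopology (\<lambda>U. U \<subseteq> gromov_carrier \<and> gromov_closed p (gromov_carrier - U))"
  unfolding istopology_def
proof (intro conjI allI impI)
  fix U V :: "('a + (real \<Rightarrow> 'a) set) set"
  assume U: "U \<subseteq> gromov_carrier \<and> gromov_closed p (gromov_carrier - U)"
    and V: "V \<subseteq> gromov_carrier \<and> gromov_closed p (gromov_carrier - V)"
  show "U \<inter> V \<subseteq> gromov_carrier" using U by auto
  show "gromov_closed p (gromov_carrier - U \<inter> V)"
    using gromov_closed_Un U V by (metis Diff_Int)
next
  fix \<U> :: "('a + (real \<Rightarrow> 'a) set) set set"
  assume *: "\<forall>U\<in>\<U>. U \<subseteq> gromov_carrier \<and> gromov_closed p (gromov_carrier - U)"
  then show "\<Union>\<U> \<subseteq> gromov_carrier" by blast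
  have "gromov_carrier - \<Union>\<U> = \<Inter>(insert gromov_carrier ((\<lambda>U. gromov_carrier - U) ` \<U>))"
    by auto
  moreover have "gromov_closed p \<dots>"
    using * gromov_closed_carrier by (intro gromov_closed_INT) auto
  ultimately show "gromov_closed p (gromov_carrier - \<Union>\<U>)" by simp
qed

lemma openin_gromov_compactification:
  "openin (gromov_compactification p) U \<longleftrightarrow>
     U \<subseteq> gromov_carrier \<and> gromov_closed p (gromov_carrier - U)"
  unfolding gromov_compactification_def by (simp only: topology_inverse'[OF istopology_gromov])

lemma topspace_gromov_compactification: "topspace (gromov_compactification p) = gromov_carrier"
proof -
  have "openin (gromov_compactification p) gromov_carrier"
    by (auto simp: openin_gromov_compactification gromov_closed_def)
  then show ?thesis
    by (metis openin_gromov_compactification openin_subset openin_topspace subset_antisym)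
qed


section \<open>The horofunction compactification\<close>

text \<open>The topology of uniform convergence on compact subsets on the continuous real functions.\<close>

definition cont_fun_topology :: "('a::metric_space \<Rightarrow> real) topology" where
  "cont_fun_topology = topology (\<lambda>U. U \<subseteq> {f. continuous_on UNIV f} \<and>
     (\<forall>f\<in>U. \<exists>K \<epsilon>. compact K \<and> \<epsilon> > 0 \<and>
        {g. continuous_on UNIV g \<and> (\<forall>x\<in>K. \<bar>g x - f x\<bar> < \<epsilon>)} \<subseteq> U))"

definition fun_class :: "('a \<Rightarrow> real) \<Rightarrow> ('a \<Rightarrow> real) set" where
  "fun_class f = {g. \<exists>c. \<forall>x. g x = f x + c}"

text \<open>The quotient topology on the continuous functions modulo constants.\<close>

definition cont_fun_mod_const_topology :: "('a::metric_space \<Rightarrow> real) set topology" where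
  "cont_fun_mod_const_topology = topology (\<lambda>V. V \<subseteq> fun_class ` {f. continuous_on UNIV f} \<and>
     openin cont_fun_topology {f. continuous_on UNIV f \<and> fun_class f \<in> V})"

definition horo_embedding :: "'a::metric_space \<Rightarrow> ('a \<Rightarrow> real) set" where
  "horo_embedding x = fun_class (\<lambda>y. dist y x)"

definition horofunction_compactification :: "('a::metric_space \<Rightarrow> real) set topology" where
  "horofunction_compactification = subtopology cont_fun_mod_const_topology
     (cont_fun_mod_const_topology closure_of range horo_embedding)"

lemma istopology_cont_fun:
  "istopology (\<lambda>U. U \<subseteq> {f::'a::metric_space \<Rightarrow> real. continuous_on UNIV f} \<and>
     (\<forall>f\<in>U. \<exists>K \<epsilon>. compact K \<and> \<epsilon> > 0 \<and>
        {g. continuous_on UNIV g \<and> (\<forall>x\<in>K. \<bar>g x - f x\<bar> < \<epsilon>)} \<subseteq> U))"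
  (is "istopology (\<lambda>U. U \<subseteq> ?C \<and> (\<forall>f\<in>U. ?N f U))")
  unfolding istopology_def
proof (intro conjI allI impI ballI)
  fix U V f
  assume U: "U \<subseteq> ?C \<and> (\<forall>f\<in>U. ?N f U)" and V: "V \<subseteq> ?C \<and> (\<forall>f\<in>V. ?N f V)"
  show "U \<inter> V \<subseteq> ?C" using U by blast
  assume f: "f \<in> U \<inter> V"
  have "?N f U" using U f by simp
  then obtain K \<epsilon> where K: "compact K" "\<epsilon> > 0"
    "{g. continuous_on UNIV g \<and> (\<forall>x\<in>K. \<bar>g x - f x\<bar> < \<epsilon>)} \<subseteq> U" by (elim exE conjE)
  have "?N f V" using V f by simp
  then obtain L \<eta> where L: "compact L" "\<eta> > 0"
    "{g. continuous_on UNIV g \<and> (\<forall>x\<in>L. \<bar>g x - f x\<bar> < \<eta>)} \<subseteq> V" by (elim exE conjE)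
  show "?N f (U \<inter> V)"
  proof (intro exI conjI)
    show "compact (K \<union> L)" "min \<epsilon> \<eta> > 0" using K(1,2) L(1,2) by auto
    have "{g. continuous_on UNIV g \<and> (\<forall>x\<in>K \<union> L. \<bar>g x - f x\<bar> < min \<epsilon> \<eta>)} \<subseteq>
        {g. continuous_on UNIV g \<and> (\<forall>x\<in>K. \<bar>g x - f x\<bar> < \<epsilon>)} \<inter>
        {g. continuous_on UNIV g \<and> (\<forall>x\<in>L. \<bar>g x - f x\<bar> < \<eta>)}" by auto
    with K(3) L(3)
    show "{g. continuous_on UNIV g \<and> (\<forall>x\<in>K \<union> L. \<bar>g x - f x\<bar> < min \<epsilon> \<eta>)} \<subseteq> U \<inter> V"
      by blast
  qed
next
  fix \<U> assume *: "\<forall>U\<in>\<U>. U \<subseteq> ?C \<and> (\<forall>f\<in>U. ?N f U)"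
  then show "\<Union>\<U> \<subseteq> ?C" by blast
  fix f assume "f \<in> \<Union>\<U>"
  then obtain U where U: "U \<in> \<U>" "f \<in> U" by blast
  have "?N f U" using * U by simp
  then obtain K \<epsilon> where K: "compact K" "\<epsilon> > 0"
    "{g. continuous_on UNIV g \<and> (\<forall>x\<in>K. \<bar>g x - f x\<bar> < \<epsilon>)} \<subseteq> U" by (elim exE conjE)
  have "U \<subseteq> \<Union>\<U>" using U(1) by blast
  with K show "?N f (\<Union>\<U>)"
    by (intro exI[of _ K] exI[of _ \<epsilon>] conjI) (simp_all only: order_trans)
qed

lemma openin_cont_fun_topology:
  "openin cont_fun_topology U \<longleftrightarrow> U \<subseteq> {f. continuous_on UNIV f} \<and>
     (\<forall>f\<in>U. \<exists>K \<epsilon>. compact K \<and> \<epsilon> > 0 \<and>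
        {g. continuous_on UNIV g \<and> (\<forall>x\<in>K. \<bar>g x - f x\<bar> < \<epsilon>)} \<subseteq> U)"
  unfolding cont_fun_topology_def by (simp only: topology_inverse'[OF istopology_cont_fun])

lemma topspace_cont_fun_topology: "topspace cont_fun_topology = {f. continuous_on UNIV f}"
proof -
  have "openin cont_fun_topology {f. continuous_on UNIV f}"
    by (auto simp: openin_cont_fun_topology intro!: exI[of _ "{}"] exI[of _ 1])
  then show ?thesis
    by (metis openin_cont_fun_topology openin_subset openin_topspace subset_antisym)
qed

lemma istopology_cont_fun_mod_const:
  "istopology (\<lambda>V. V \<subseteq> fun_class ` {f::'a::metric_space \<Rightarrow> real. continuous_on UNIV f} \<and>
     openin cont_fun_topology {f. continuous_on UNIV f \<and> fun_class f \<in> V})"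
  (is "istopology (\<lambda>V. V \<subseteq> ?Q \<and> openin _ (?pre V))")
  unfolding istopology_def
proof (intro conjI allI impI)
  fix U V assume U: "U \<subseteq> ?Q \<and> openin cont_fun_topology (?pre U)"
    and V: "V \<subseteq> ?Q \<and> openin cont_fun_topology (?pre V)"
  show "U \<inter> V \<subseteq> ?Q" using U by blast
  have "?pre (U \<inter> V) = ?pre U \<inter> ?pre V" by blast
  then show "openin cont_fun_topology (?pre (U \<inter> V))" using U V by auto
next
  fix \<U> assume *: "\<forall>U\<in>\<U>. U \<subseteq> ?Q \<and> openin cont_fun_topology (?pre U)"
  then show "\<Union>\<U> \<subseteq> ?Q" by blast
  have "?pre (\<Union>\<U>) = \<Union>(?pre ` \<U>)" by blast
  then show "openin cont_fun_topology (?pre (\<Union>\<U>))" using * by auto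
qed

lemma quotient_map_fun_class:
  "quotient_map cont_fun_topology cont_fun_mod_const_topology fun_class"
proof -
  have op: "openin cont_fun_mod_const_topology V \<longleftrightarrow> V \<subseteq> fun_class ` {f. continuous_on UNIV f} \<and>
      openin cont_fun_topology {f. continuous_on UNIV f \<and> fun_class f \<in> V}"
    for V :: "('a::metric_space \<Rightarrow> real) set set"
    unfolding cont_fun_mod_const_topology_def
    by (simp only: topology_inverse'[OF istopology_cont_fun_mod_const])
  have "{f::'a \<Rightarrow> real. continuous_on UNIV f \<and> fun_class f \<in> fun_class ` {f. continuous_on UNIV f}} =
      {f. continuous_on UNIV f}"
    by blast
  then have "openin cont_fun_mod_const_topology (fun_class ` {f::'a \<Rightarrow> real. continuous_on UNIV f})"
    unfolding op using openin_topspace[of "cont_fun_topology :: ('a \<Rightarrow> real) topology"]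
    by (simp only: topspace_cont_fun_topology subset_refl simp_thms)
  then have "topspace cont_fun_mod_const_topology = fun_class ` {f::'a \<Rightarrow> real. continuous_on UNIV f}"
    by (metis op openin_subset openin_topspace subset_antisym)
  then show ?thesis
    by (auto simp: quotient_map_def topspace_cont_fun_topology op)
qed

definition busemann :: "(real \<Rightarrow> 'a::metric_space) \<Rightarrow> 'a \<Rightarrow> 'a \<Rightarrow> real" where
  "busemann \<gamma> x y = Lim at_top (\<lambda>t. dist x (\<gamma> t) - dist (\<gamma> t) y)"


section \<open>The weak approaching geodesics property and the comparison map\<close>

definition weak_approaching_geodesics :: "(real \<Rightarrow> 'a::metric_space) set \<Rightarrow> bool" where
  "weak_approaching_geodesics F \<longleftrightarrow>
     (\<forall>p. \<forall>\<xi>\<in>gromov_boundary. \<forall>x :: nat \<Rightarrow> 'a. gromov_converges p (Inl \<circ> x) \<xi> \<longrightarrow>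
        (\<exists>r g. strict_mono r \<and> (\<forall>k. geodesic_from_to p (Inl (x (r k))) (g k)) \<and>
           (\<exists>h\<in>F. geodesic_ray h \<and> locally_uniform_limit g h))) \<and>
     (\<forall>\<gamma>\<in>F. \<forall>\<sigma>\<in>F. asymptotic_rays \<gamma> \<sigma> \<longrightarrow> strongly_asymptotic_rays \<gamma> \<sigma>)"

text \<open>
  On a boundary point the map is defined through an arbitrary representing ray \<open>\<gamma>\<close> and the second
  argument \<open>\<gamma> 0\<close> of its Busemann function. Independence of both choices is part of the theorem.
\<close>

fun gromov_to_horo :: "'a::metric_space + (real \<Rightarrow> 'a) set \<Rightarrow> ('a \<Rightarrow> real) set" where
  "gromov_to_horo (Inl x) = fun_class (\<lambda>y. dist y x)"
| "gromov_to_horo (Inr \<xi>) = (let \<gamma> = (SOME \<gamma>. \<gamma> \<in> \<xi>) in fun_class (\<lambda>x. busemann \<gamma> x (\<gamma> 0)))"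

definition topologically_equivalent ::
    "'b topology \<Rightarrow> ('a \<Rightarrow> 'b) \<Rightarrow> 'c topology \<Rightarrow> ('a \<Rightarrow> 'c) \<Rightarrow> bool" where
  "topologically_equivalent Y i Z j \<longleftrightarrow>
     (\<exists>h. homeomorphic_map Y Z h \<and> (\<forall>x. h (i x) = j x))"

end

theory Submission
  imports Defs
begin

text \<open>
  Let \<open>x\<^sub>n\<close> be points of \<open>X\<close> converging to \<open>\<xi>\<close> in the Gromov boundary. For every base point \<open>q\<close>, segments from
  \<open>q\<close> to \<open>x\<^sub>n\<close> subconverge to a ray of \<open>F\<close> issuing from \<open>q\<close>, and going along this ray bounds
  \<open>d(y, x\<^sub>n) - d(q, x\<^sub>n)\<close> from above by its Busemann function. All rays of \<open>F\<close> in the class \<open>\<xi>\<close> are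
  strongly asymptotic, so they share one Busemann function \<open>B\<close>. As \<open>q\<close> and \<open>y\<close> can be exchanged, the
  upper bound for \<open>(q, y)\<close> is the lower bound for \<open>(y, q)\<close>, and \<open>d(y, x\<^sub>n) - d(q, x\<^sub>n)\<close> converges to \<open>B(y, q)\<close>.
  Points running along any ray of \<open>\<xi>\<close> show that its Busemann function is \<open>B\<close> as well. Boundary points are
  approximated by interior points on rays from the base point, so the comparison map is sequentially
  continuous on the whole compactification. Hyperbolicity enters through the fellow travelling of geodesics; it gives
  sequential compactness by Arzela-Ascoli, and injectivity, since equal Busemann functions force large Gromov
  products of the points of two rays. A sequentially compact domain makes the map closed.
\<close>

section \<open>Geodesics to points of the compactification\<close>

lemma geodesic_on_dist: "geodesic_on I \<gamma> \<Longrightarrow> s \<in> I \<Longrightarrow> t \<in> I \<Longrightarrow> dist (\<gamma> s) (\<gamma> t) = \<bar>t - s\<bar>"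
  by (simp add: geodesic_on_def)

lemma geodesic_on_subset: "geodesic_on I \<gamma> \<Longrightarrow> J \<subseteq> I \<Longrightarrow> geodesic_on J \<gamma>"
  by (auto simp: geodesic_on_def)

lemma geodesic_ray_dist: "geodesic_ray \<gamma> \<Longrightarrow> 0 \<le> s \<Longrightarrow> 0 \<le> t \<Longrightarrow> dist (\<gamma> s) (\<gamma> t) = \<bar>t - s\<bar>"
  by (simp add: geodesic_ray_def geodesic_on_def)

lemma geodesic_segmentI: "geodesic_on {0..T} \<gamma> \<Longrightarrow> 0 \<le> T \<Longrightarrow> geodesic_segment (\<gamma> 0) (\<gamma> T) \<gamma>"
  using geodesic_on_dist[of "{0..T}" \<gamma> 0 T] by (simp add: geodesic_segment_def)

lemma geodesic_ray_segment: "geodesic_ray \<gamma> \<Longrightarrow> 0 \<le> T \<Longrightarrow> geodesic_segment (\<gamma> 0) (\<gamma> T) \<gamma>"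
  by (rule geodesic_segmentI) (auto simp: geodesic_ray_def intro: geodesic_on_subset)

lemma geodesic_segment_reverse:
  assumes "geodesic_segment x y \<gamma>"
  shows "geodesic_segment y x (\<lambda>t. \<gamma> (dist x y - t))"
  using assms by (auto simp: geodesic_segment_def geodesic_on_def dist_commute)

section \<open>Asymptoticity classes of rays\<close>

lemma asymptotic_rays_iff: "asymptotic_rays \<gamma> \<sigma> \<longleftrightarrow> (\<exists>M. \<forall>t\<ge>0. dist (\<gamma> t) (\<sigma> t) \<le> M)"
  by (simp add: asymptotic_rays_def bounded_real) (simp add: Ball_def)

lemma ray_class_self: "geodesic_ray \<gamma> \<Longrightarrow> \<gamma> \<in> ray_class \<gamma>"
  by (auto simp: ray_class_def asymptotic_rays_iff)

lemma ray_class_in_boundary: "geodesic_ray \<gamma> \<Longrightarrow> ray_class \<gamma> \<in> gromov_boundary"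
  by (auto simp: gromov_boundary_def)

lemma boundary_nonempty: "\<xi> \<in> gromov_boundary \<Longrightarrow> \<exists>\<gamma>. \<gamma> \<in> \<xi>"
  using ray_class_self by (auto simp: gromov_boundary_def)

lemma boundary_ray: "\<xi> \<in> gromov_boundary \<Longrightarrow> \<gamma> \<in> \<xi> \<Longrightarrow> geodesic_ray \<gamma>"
  by (auto simp: gromov_boundary_def ray_class_def)

lemma boundary_asymptotic:
  assumes "\<xi> \<in> gromov_boundary" "\<gamma> \<in> \<xi>" "\<sigma> \<in> \<xi>"
  shows "asymptotic_rays \<gamma> \<sigma>"
proof -
  obtain \<alpha> where \<alpha>: "\<xi> = ray_class \<alpha>" using assms by (auto simp: gromov_boundary_def)
  then obtain M N where "\<forall>t\<ge>0. dist (\<alpha> t) (\<gamma> t) \<le> M" "\<forall>t\<ge>0. dist (\<alpha> t) (\<sigma> t) \<le> N"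
    using assms by (auto simp: ray_class_def asymptotic_rays_iff)
  then have "\<forall>t\<ge>0. dist (\<gamma> t) (\<sigma> t) \<le> M + N"
    by (smt (verit) dist_triangle3)
  then show ?thesis by (auto simp: asymptotic_rays_iff)
qed

lemma boundary_mem:
  assumes "\<xi> \<in> gromov_boundary" "\<gamma> \<in> \<xi>" "geodesic_ray \<sigma>" "\<And>t. t \<ge> 0 \<Longrightarrow> dist (\<gamma> t) (\<sigma> t) \<le> M"
  shows "\<sigma> \<in> \<xi>"
proof -
  obtain \<alpha> where \<alpha>: "\<xi> = ray_class \<alpha>" using assms by (auto simp: gromov_boundary_def)
  then obtain N where "\<forall>t\<ge>0. dist (\<alpha> t) (\<gamma> t) \<le> N"
    using assms by (auto simp: ray_class_def asymptotic_rays_iff)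
  then have "\<forall>t\<ge>0. dist (\<alpha> t) (\<sigma> t) \<le> N + M"
    using assms(4) by (smt (verit) dist_triangle)
  then show ?thesis using assms(3) \<alpha> by (auto simp: ray_class_def asymptotic_rays_iff)
qed

lemma boundary_eqI:
  assumes "\<xi> \<in> gromov_boundary" "\<xi>' \<in> gromov_boundary" "\<gamma> \<in> \<xi>" "\<gamma> \<in> \<xi>'"
  shows "\<xi> = \<xi>'"
proof -
  have "A \<subseteq> B" if AB: "A \<in> gromov_boundary" "B \<in> gromov_boundary" "\<gamma> \<in> A" "\<gamma> \<in> B" for A B
  proof
    fix \<sigma> assume \<sigma>: "\<sigma> \<in> A"
    then obtain M where "\<And>t. t \<ge> 0 \<Longrightarrow> dist (\<gamma> t) (\<sigma> t) \<le> M"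
      using boundary_asymptotic[OF AB(1,3) \<sigma>] unfolding asymptotic_rays_iff by blast
    then show "\<sigma> \<in> B"
      by (rule boundary_mem[OF AB(2,4) boundary_ray[OF AB(1) \<sigma>]])
  qed
  then show ?thesis using assms by blast
qed

lemma ray_class_eq: "\<xi> \<in> gromov_boundary \<Longrightarrow> \<gamma> \<in> \<xi> \<Longrightarrow> ray_class \<gamma> = \<xi>"
  using boundary_eqI[of "ray_class \<gamma>" \<xi> \<gamma>] boundary_ray ray_class_in_boundary ray_class_self by blast

section \<open>Prolonged geodesics from a base point and their limits\<close>

lemma Inl_in_gromov_carrier [simp]: "Inl x \<in> gromov_carrier"
  by (simp add: gromov_carrier_def)

lemma Inr_in_gromov_carrier [simp]: "Inr \<xi> \<in> gromov_carrier \<longleftrightarrow> \<xi> \<in> gromov_boundary"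
  by (auto simp: gromov_carrier_def)

text \<open>Dispenses with the auxiliary segment of the definition: \<open>g\<close> itself serves,
  as its values at negative reals are not constrained.\<close>

lemma geodesic_from_to_Inl:
  "geodesic_from_to p (Inl x) g \<longleftrightarrow> geodesic_segment p x g \<and> (\<forall>t\<ge>dist p x. g t = x)" (is "?L \<longleftrightarrow> ?R")
proof
  assume ?L
  then obtain \<gamma> where \<gamma>: "geodesic_segment p x \<gamma>" "\<forall>t\<ge>0. g t = \<gamma> (min t (dist p x))"
    by auto
  then show ?R
    by (auto simp: geodesic_segment_def geodesic_on_def min_def order_trans[OF zero_le_dist])
next
  assume ?R
  then have "\<forall>t\<ge>0. g t = g (min t (dist p x))"
    by (auto simp: geodesic_segment_def min_def)
  with \<open>?R\<close> show ?L unfolding geodesic_from_to.simps by blast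
qed

declare geodesic_from_to.simps(1) [simp del]

text \<open>The domain of a geodesic from \<open>p\<close> to \<open>c\<close>, before prolongation, contains \<open>{0..T}\<close>.\<close>

definition reaches :: "'a::metric_space \<Rightarrow> 'a + (real \<Rightarrow> 'a) set \<Rightarrow> real \<Rightarrow> bool" where
  "reaches p c T \<longleftrightarrow> (case c of Inl x \<Rightarrow> T \<le> dist p x | Inr _ \<Rightarrow> True)"

lemma reaches_simps [simp]: "reaches p (Inl x) T \<longleftrightarrow> T \<le> dist p x" "reaches p (Inr \<xi>) T"
  by (simp_all add: reaches_def)

lemma from_to_start: "geodesic_from_to p c g \<Longrightarrow> g 0 = p"
  by (cases c) (auto simp: geodesic_from_to_Inl geodesic_segment_def)

lemma from_to_geodesic_on:
  assumes "geodesic_from_to p c g" "c \<in> gromov_carrier" "reaches p c T"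
  shows "geodesic_on {0..T} g"
proof (cases c)
  case (Inl x)
  then show ?thesis using assms
    by (auto simp: geodesic_from_to_Inl geodesic_segment_def intro: geodesic_on_subset)
next
  case (Inr \<xi>)
  then have "geodesic_ray g" using assms boundary_ray by auto
  then show ?thesis by (auto simp: geodesic_ray_def intro: geodesic_on_subset)
qed

text \<open>A prolonged segment rests at its end point, so the Lipschitz bound survives the
  prolongation. This equicontinuity turns pointwise limits of geodesics into locally uniform
  ones.\<close>

lemma from_to_lipschitz:
  assumes "geodesic_from_to p c g" "c \<in> gromov_carrier" "0 \<le> s" "0 \<le> t"
  shows "dist (g s) (g t) \<le> \<bar>t - s\<bar>"
proof (cases c)
  case (Inl x)
  have 1: "dist (g u) (g v) \<le> v - u" if "0 \<le> u" "u \<le> v" for u v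
  proof -
    have *: "geodesic_on {0..dist p x} g" "\<And>t. t \<ge> dist p x \<Longrightarrow> g t = x" "g (dist p x) = x"
      using assms Inl by (auto simp: geodesic_from_to_Inl geodesic_segment_def)
    consider "v \<le> dist p x" | "u \<le> dist p x" "dist p x \<le> v" | "dist p x \<le> u" by linarith
    then show ?thesis
    proof cases
      case 1
      then show ?thesis using that *(1) by (auto simp: geodesic_on_def)
    next
      case 2
      then have "dist (g u) (g (dist p x)) = dist p x - u"
        using that *(1) by (auto simp: geodesic_on_def)
      then show ?thesis using 2 * by simp
    next
      case 3
      then show ?thesis using * that by simp
    qed
  qed
  show ?thesis
    using 1[of s t] 1[of t s] assms by (cases "s \<le> t") (auto simp: dist_commute)
next
  case (Inr \<xi>)
  then show ?thesis using assms boundary_ray geodesic_ray_dist by fastforce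
qed

lemma from_to_dist_reaches:
  assumes "geodesic_from_to p c g" "c \<in> gromov_carrier" "0 \<le> t" "T \<le> dist (g 0) (g t)"
  shows "reaches p c T"
proof (cases c)
  case (Inl x)
  have *: "geodesic_on {0..dist p x} g" "g 0 = p" "\<And>t. t \<ge> dist p x \<Longrightarrow> g t = x"
    using assms(1) Inl by (auto simp: geodesic_from_to_Inl geodesic_segment_def)
  then have "dist (g 0) (g t) \<le> dist p x"
    using geodesic_on_dist[OF *(1), of 0 t] assms(3) by (cases "t \<le> dist p x") auto
  then show ?thesis using Inl assms(4) by simp
qed simp

text \<open>The limit inherits the Lipschitz bound, and closeness on a finite \<epsilon>/3-net of
  the compact set spreads to all of it. Used for geodesics and again for horofunctions.\<close>

lemma uniform_limit_lipschitz:
  fixes f :: "nat \<Rightarrow> 'a::metric_space \<Rightarrow> 'b::metric_space"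
  assumes lip: "\<And>n x y. x \<in> K \<Longrightarrow> y \<in> K \<Longrightarrow> dist (f n x) (f n y) \<le> dist x y"
    and lim: "\<And>x. x \<in> K \<Longrightarrow> (\<lambda>n. f n x) \<longlonglongrightarrow> h x"
    and K: "compact K"
  shows "uniform_limit K f h sequentially"
  unfolding uniform_limit_iff
proof (intro allI impI)
  fix \<epsilon> :: real assume "\<epsilon> > 0"
  have hlip: "dist (h x) (h y) \<le> dist x y" if "x \<in> K" "y \<in> K" for x y
    by (rule tendsto_upperbound[OF tendsto_dist[OF lim lim]]) (use that lip in auto)
  have "K \<subseteq> (\<Union>x\<in>K. ball x (\<epsilon>/3))" using \<open>\<epsilon> > 0\<close> by force
  then obtain D where D: "D \<subseteq> K" "finite D" "K \<subseteq> (\<Union>x\<in>D. ball x (\<epsilon>/3))"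
    by (rule compactE_image[OF K open_ball])
  have "\<forall>\<^sub>F n in sequentially. \<forall>x\<in>D. dist (f n x) (h x) < \<epsilon>/3"
    using D \<open>\<epsilon> > 0\<close> by (intro eventually_ball_finite ballI tendstoD[OF lim]) auto
  then show "\<forall>\<^sub>F n in sequentially. \<forall>x\<in>K. dist (f n x) (h x) < \<epsilon>"
  proof eventually_elim
    case (elim n)
    show ?case
    proof
      fix x assume x: "x \<in> K"
      then obtain y where y: "y \<in> D" "dist y x < \<epsilon>/3" using D by auto
      have "dist (f n x) (f n y) < \<epsilon>/3" "dist (h x) (h y) < \<epsilon>/3" "dist (f n y) (h y) < \<epsilon>/3"
        using lip[of x y n] hlip[of x y] y x D elim by (auto simp: dist_commute)
      then show "dist (f n x) (h x) < \<epsilon>"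
        by metric
    qed
  qed
qed

lemma locally_uniform_limit_from_to:
  assumes "\<And>n. geodesic_from_to p (c n) (g n)" "\<And>n. c n \<in> gromov_carrier"
  shows "locally_uniform_limit g h \<longleftrightarrow> (\<forall>t\<ge>0. (\<lambda>n. g n t) \<longlonglongrightarrow> h t)"
proof
  assume *: "locally_uniform_limit g h"
  show "\<forall>t\<ge>0. (\<lambda>n. g n t) \<longlonglongrightarrow> h t"
  proof (intro allI impI)
    fix t :: real assume "0 \<le> t"
    then have "uniform_limit {t} g h sequentially" using * by (auto simp: locally_uniform_limit_def)
    then show "(\<lambda>n. g n t) \<longlonglongrightarrow> h t" by (auto intro: tendsto_uniform_limitI)
  qed
next
  assume *: "\<forall>t\<ge>0. (\<lambda>n. g n t) \<longlonglongrightarrow> h t"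
  show "locally_uniform_limit g h"
    unfolding locally_uniform_limit_def
  proof (intro allI impI)
    fix K :: "real set" assume K: "K \<subseteq> {0..}" "compact K"
    show "uniform_limit K g h sequentially"
    proof (rule uniform_limit_lipschitz[OF _ _ K(2)])
      fix n x y assume "x \<in> K" "y \<in> K"
      then show "dist (g n x) (g n y) \<le> dist x y"
        using from_to_lipschitz[OF assms] K by (auto simp: dist_real_def abs_minus_commute)
    qed (use * K in auto)
  qed
qed

text \<open>Every bounded interval eventually lies in the domains of the geodesics before
  prolongation, where distances are exact; these pass to the limit.\<close>

lemma from_to_limit_ray:
  assumes g: "\<And>n. geodesic_from_to p (c n) (g n)" and c: "\<And>n. c n \<in> gromov_carrier"
    and lim: "\<And>t. t \<ge> 0 \<Longrightarrow> (\<lambda>n. g n t) \<longlonglongrightarrow> h t"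
    and reach: "\<And>T. \<forall>\<^sub>F n in sequentially. reaches p (c n) T"
  shows "geodesic_ray h" "h 0 = p"
proof -
  have "dist (h s) (h t) = \<bar>t - s\<bar>" if "0 \<le> s" "0 \<le> t" for s t
  proof -
    have "\<forall>\<^sub>F n in sequentially. dist (g n s) (g n t) = \<bar>t - s\<bar>"
      using reach[of "max s t"]
    proof eventually_elim
      case (elim n)
      show ?case
        by (rule geodesic_on_dist[OF from_to_geodesic_on[OF g c elim]]) (use that in auto)
    qed
    then have "(\<lambda>n. dist (g n s) (g n t)) \<longlonglongrightarrow> \<bar>t - s\<bar>"
      by (rule tendsto_eventually)
    then show ?thesis
      using LIMSEQ_unique tendsto_dist[OF lim lim] that by blast
  qed
  then show "geodesic_ray h" by (auto simp: geodesic_ray_def geodesic_on_def)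
  have "(\<lambda>n. g n 0) = (\<lambda>_. p)" using from_to_start[OF g] by auto
  then show "h 0 = p" using lim[of 0] by (simp add: LIMSEQ_const_iff)
qed

text \<open>A converse of the preceding lemma: a ray leaves every ball about its origin, so
  geodesics converging to it must become long.\<close>

lemma from_to_reaches:
  assumes g: "\<And>n. geodesic_from_to p (c n) (g n)" and c: "\<And>n. c n \<in> gromov_carrier"
    and lim: "\<And>t. t \<ge> 0 \<Longrightarrow> (\<lambda>n. g n t) \<longlonglongrightarrow> h t"
    and h: "geodesic_ray h"
  shows "\<forall>\<^sub>F n in sequentially. reaches p (c n) T"
proof -
  \<comment> \<open>The extra 1 makes the limit distance strictly larger than \<open>T\<close>, so
    that \<open>T\<close> is eventually exceeded along the sequence.\<close>
  define t where "t = max 0 T + 1"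
  have "(\<lambda>n. dist (g n 0) (g n t)) \<longlonglongrightarrow> dist (h 0) (h t)"
    by (intro tendsto_dist lim) (auto simp: t_def)
  moreover have "T < dist (h 0) (h t)"
    using geodesic_ray_dist[OF h, of 0 t] by (auto simp: t_def)
  ultimately have "\<forall>\<^sub>F n in sequentially. T < dist (g n 0) (g n t)"
    by (rule order_tendstoD)
  then show ?thesis
  proof eventually_elim
    case (elim n)
    show ?case
      by (rule from_to_dist_reaches[OF g c, of t]) (use elim in \<open>auto simp: t_def\<close>)
  qed
qed

text \<open>Arzela-Ascoli: compactness of a product of balls gives convergence at all rational
  times, the common Lipschitz bound gives the Cauchy property at the other times, and closed balls
  are complete.\<close>

lemma from_to_subsequence:
  fixes g :: "nat \<Rightarrow> real \<Rightarrow> 'a::metric_space"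
  assumes proper: "\<And>(x::'a) r. compact (cball x r)"
    and g: "\<And>n. geodesic_from_to p (c n) (g n)" and c: "\<And>n. c n \<in> gromov_carrier"
  obtains r :: "nat \<Rightarrow> nat" and h where "strict_mono r"
    "\<And>t. t \<ge> 0 \<Longrightarrow> (\<lambda>n. g (r n) t) \<longlonglongrightarrow> h t"
proof -
  \<comment> \<open>Absolute values send all rationals to nonnegative times. The index type is
    countable, so the compact product is also sequentially compact.\<close>
  define G where "G n i = g n \<bar>of_rat i\<bar>" for n and i :: rat
  define S where "S = (\<Pi>\<^sub>E i\<in>UNIV. cball p \<bar>of_rat i\<bar>)"
  have lip: "dist (g n s) (g n t) \<le> \<bar>t - s\<bar>" if "0 \<le> s" "0 \<le> t" for n s t
    using from_to_lipschitz[OF g c that] .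
  have "compactin (product_topology (\<lambda>_. euclidean) UNIV) S"
    unfolding S_def by (subst compactin_PiE) (simp add: proper)
  then have "compact S" by (simp add: euclidean_product_topology)
  then have "seq_compact S" by (rule compact_imp_seq_compact)
  moreover have "G n \<in> S" for n
  proof -
    have "dist p (G n i) \<le> \<bar>of_rat i\<bar>" for i
      using lip[of 0 "\<bar>of_rat i\<bar>" n] from_to_start[OF g, of n] by (simp add: G_def)
    then show ?thesis by (auto simp: S_def PiE_UNIV_domain)
  qed
  ultimately obtain r L where r: "strict_mono r" and L: "(G \<circ> r) \<longlonglongrightarrow> L"
    unfolding seq_compact_def by metis
  have "(\<lambda>n. G (r n) i) \<longlonglongrightarrow> L i" for i
  proof -
    have "limitin (product_topology (\<lambda>_. euclidean) UNIV) (G \<circ> r) L sequentially"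
      using L by (simp add: euclidean_product_topology)
    then show ?thesis by (simp add: limitin_componentwise)
  qed
  have "Cauchy (\<lambda>n. g (r n) t)" if "0 \<le> t" for t
  proof (rule metric_CauchyI)
    fix e :: real assume "e > 0"
    \<comment> \<open>A rational time to the right of \<open>t\<close> is positive, so its absolute
      value disappears; the error splits as e/4 + e/2 + e/4.\<close>
    then obtain q where q: "t < of_rat q" "of_rat q < t + e/4"
      using of_rat_dense[of t "t + e/4"] by auto
    have "Cauchy (\<lambda>n. G (r n) q)"
      using \<open>(\<lambda>n. G (r n) q) \<longlonglongrightarrow> L q\<close> by (rule LIMSEQ_imp_Cauchy)
    then obtain M where M: "\<forall>m\<ge>M. \<forall>n\<ge>M. dist (G (r m) q) (G (r n) q) < e/2"
      using \<open>e > 0\<close> by (meson half_gt_zero metric_CauchyD)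
    have "dist (g (r m) t) (g (r n) t) < e" if "m \<ge> M" "n \<ge> M" for m n
    proof -
      have "0 < (of_rat q :: real)" using q \<open>0 \<le> t\<close> by linarith
      then have "dist (g k t) (G k q) < e/4" for k
        using lip[of t "of_rat q" k] q \<open>0 \<le> t\<close> by (simp add: G_def)
      from this[of "r m"] this[of "r n"] M[rule_format, OF that]
      show ?thesis by metric
    qed
    then show "\<exists>M. \<forall>m\<ge>M. \<forall>n\<ge>M. dist (g (r m) t) (g (r n) t) < e" by blast
  qed
  moreover have "g (r n) t \<in> cball p t" if "0 \<le> t" for n t
    using lip[of 0 t "r n"] from_to_start[OF g] that by auto
  ultimately have "\<exists>l. (\<lambda>n. g (r n) t) \<longlonglongrightarrow> l" if "0 \<le> t" for t
    using completeE[OF compact_imp_complete[OF proper, of p t], of "\<lambda>n. g (r n) t"] that by blast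
  then have "\<forall>t\<in>{0..}. \<exists>l. (\<lambda>n. g (r n) t) \<longlonglongrightarrow> l" by simp
  then obtain h where h: "\<forall>t\<in>{0..}. (\<lambda>n. g (r n) t) \<longlonglongrightarrow> h t" by (rule bchoice[THEN exE])
  then have "\<And>t. t \<ge> 0 \<Longrightarrow> (\<lambda>n. g (r n) t) \<longlonglongrightarrow> h t" by simp
  with r show ?thesis by (rule that)
qed

section \<open>Convergence to the Gromov boundary\<close>

lemma not_eventually_subseq:
  assumes "\<not> (\<forall>\<^sub>F n in sequentially. P n)"
  obtains r :: "nat \<Rightarrow> nat" where "strict_mono r" "\<And>n. \<not> P (r n)"
proof -
  have "infinite {n. \<not> P n}"
    using assms by (simp add: eventually_cofinite flip: cofinite_eq_sequentially)
  then show ?thesis using infinite_enumerate that by blast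
qed

text \<open>Prolonged geodesics are equicontinuous, so from here on convergence is handled through
  pointwise limits.\<close>

lemma gromov_converges_iff:
  assumes "\<And>n. c n \<in> gromov_carrier"
  shows "gromov_converges p c \<xi> \<longleftrightarrow>
     (\<forall>n. \<exists>g. geodesic_from_to p (c n) g) \<and>
     (\<forall>g r h. (\<forall>n. geodesic_from_to p (c n) (g n)) \<and> strict_mono r \<and>
        (\<forall>t\<ge>0. (\<lambda>n. g (r n) t) \<longlonglongrightarrow> h t) \<longrightarrow> h \<in> \<xi>)"
proof -
  have "locally_uniform_limit (g \<circ> r) h \<longleftrightarrow> (\<forall>t\<ge>0. (\<lambda>n. g (r n) t) \<longlonglongrightarrow> h t)"
    if "\<forall>n. geodesic_from_to p (c n) (g n)" for g :: "nat \<Rightarrow> real \<Rightarrow> 'a" and h r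
    using locally_uniform_limit_from_to[of p "c \<circ> r" "g \<circ> r" h] assms that by simp
  then show ?thesis unfolding gromov_converges_def by blast
qed

lemma gromov_converges_limit:
  assumes "gromov_converges p c \<xi>" "\<And>n. c n \<in> gromov_carrier" "\<And>n. geodesic_from_to p (c n) (g n)"
    "strict_mono r" "\<And>t. t \<ge> 0 \<Longrightarrow> (\<lambda>n. g (r n) t) \<longlonglongrightarrow> h t"
  shows "h \<in> \<xi>"
proof -
  have "\<forall>g r h. (\<forall>n. geodesic_from_to p (c n) (g n)) \<and> strict_mono r \<and>
        (\<forall>t\<ge>0. (\<lambda>n. g (r n) t) \<longlonglongrightarrow> h t) \<longrightarrow> h \<in> \<xi>"
    using assms(1) gromov_converges_iff[of c p \<xi>, OF assms(2)] by blast
  from this[rule_format, of g r h] show ?thesis using assms(3-5) by blast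
qed

lemma gromov_converges_from_to:
  assumes "gromov_converges p c \<xi>"
  obtains g where "\<And>n. geodesic_from_to p (c n) (g n)"
proof -
  have "\<forall>n. \<exists>g. geodesic_from_to p (c n) g" using assms by (simp add: gromov_converges_def)
  then show ?thesis using that by metis
qed

section \<open>Slim triangles and fellow travelling\<close>

locale hyperbolic_space =
  fixes \<delta> :: real and X :: "'a::metric_space itself"
  assumes compact_cball: "compact (cball (x::'a) r)"
    and ex_segment: "\<exists>\<gamma>. geodesic_segment (x::'a) y \<gamma>"
    and \<delta>_nonneg: "0 \<le> \<delta>"
    and slim: "\<lbrakk>geodesic_segment (x::'a) y \<alpha>; geodesic_segment y z \<beta>; geodesic_segment x z \<gamma>;
        s \<in> {0..dist x y}\<rbrakk> \<Longrightarrow>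
      \<exists>q \<in> \<beta> ` {0..dist y z} \<union> \<gamma> ` {0..dist x z}. dist (\<alpha> s) q \<le> \<delta>"
begin

text \<open>Below the Gromov product \<open>(a|b)\<^sub>p\<close>, which bounds the distance from \<open>p\<close> to the side
  from \<open>a\<close> to \<open>b\<close> from below, only the sides at \<open>p\<close> can be close to each other.\<close>

lemma fellow_travel:
  fixes p a b :: 'a
  assumes \<alpha>: "geodesic_segment p a \<alpha>" and \<sigma>: "geodesic_segment p b \<sigma>"
    and u: "0 \<le> u" "u + \<delta> < (dist p a + dist p b - dist a b) / 2"
  shows "dist (\<sigma> u) (\<alpha> u) \<le> 2 * \<delta>"
proof -
  obtain \<beta> where \<beta>: "geodesic_segment b a \<beta>" using ex_segment by blast
  have ub: "u \<le> dist p b" and ua: "u \<le> dist p a"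
    using u \<delta>_nonneg dist_triangle[of p a b] dist_triangle[of p b a] by (auto simp: dist_commute)
  have "dist p (\<sigma> u) = u"
    using \<sigma> u(1) ub geodesic_on_dist[of "{0..dist p b}" \<sigma> 0 u] by (auto simp: geodesic_segment_def)
  obtain q where q: "q \<in> \<beta> ` {0..dist b a} \<union> \<alpha> ` {0..dist p a}" "dist (\<sigma> u) q \<le> \<delta>"
    using slim[OF \<sigma> \<beta> \<alpha>, of u] u(1) ub by auto
  from q(1) show ?thesis
  proof
    assume "q \<in> \<beta> ` {0..dist b a}"
    then obtain v where v: "q = \<beta> v" "0 \<le> v" "v \<le> dist b a" by auto
    \<comment> \<open>Adding two triangle inequalities, a point on the side from \<open>b\<close> to
      \<open>a\<close> is at distance at least the Gromov product from \<open>p\<close>; but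
      \<open>q\<close> is closer than that.\<close>
    then have "dist b q = v" "dist q a = dist b a - v"
      using \<beta> geodesic_on_dist[of "{0..dist b a}" \<beta> 0 v]
        geodesic_on_dist[of "{0..dist b a}" \<beta> v "dist b a"]
      by (auto simp: geodesic_segment_def)
    moreover have "dist p q \<le> u + \<delta>"
      using q(2) \<open>dist p (\<sigma> u) = u\<close> dist_triangle[of p q "\<sigma> u"] by linarith
    ultimately have False
      using u(2) dist_triangle[of p b q] dist_triangle[of p a q] by (simp add: dist_commute)
    then show ?thesis ..
  next
    assume "q \<in> \<alpha> ` {0..dist p a}"
    then obtain v where v: "q = \<alpha> v" "0 \<le> v" "v \<le> dist p a" by auto
    \<comment> \<open>Parameters are distances from \<open>p\<close>, so \<open>u\<close> and
      \<open>v\<close> differ by at most \<delta>; sliding along \<open>\<alpha>\<close> from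
      \<open>v\<close> to \<open>u\<close> costs this second \<delta>.\<close>
    have "dist p q = v" "dist q (\<alpha> u) = \<bar>u - v\<bar>"
      using \<alpha> v u(1) ua geodesic_on_dist[of "{0..dist p a}" \<alpha> 0 v]
        geodesic_on_dist[of "{0..dist p a}" \<alpha> v u]
      by (auto simp: geodesic_segment_def)
    then show ?thesis
      using q(2) \<open>dist p (\<sigma> u) = u\<close> dist_triangle[of p q "\<sigma> u"] dist_triangle[of p "\<sigma> u" q]
        dist_triangle[of "\<sigma> u" "\<alpha> u" q]
      by (simp add: dist_commute)
  qed
qed

text \<open>In a slim triangle with vertices \<open>p\<close>, \<open>q\<close> and
  \<open>a\<close>, the point \<open>\<alpha> t\<close> is near \<open>\<beta>\<close> or near the
  side from \<open>p\<close> to \<open>q\<close>. In the first case the parameters differ by at most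
  \<open>dist p q + \<delta>\<close>; in the second \<open>t\<close> itself has this bound, which
  produces the factor 3.\<close>

lemma fellow_travel_bases:
  fixes p q a :: 'a
  assumes \<alpha>: "geodesic_segment p a \<alpha>" and \<beta>: "geodesic_segment q a \<beta>"
    and t: "0 \<le> t" "t \<le> dist p a" "t \<le> dist q a"
  shows "dist (\<alpha> t) (\<beta> t) \<le> 3 * dist p q + 2 * \<delta>"
proof -
  obtain \<gamma> where \<gamma>: "geodesic_segment p q \<gamma>" using ex_segment by blast
  have pt: "dist p (\<alpha> t) = t"
    using \<alpha> t geodesic_on_dist[of "{0..dist p a}" \<alpha> 0 t] by (auto simp: geodesic_segment_def)
  have \<beta>_dist: "dist q (\<beta> s) = s" "dist (\<beta> s) (\<beta> t) = \<bar>t - s\<bar>" if "0 \<le> s" "s \<le> dist q a" for s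
    using \<beta> t that geodesic_on_dist[of "{0..dist q a}" \<beta> 0 s]
      geodesic_on_dist[of "{0..dist q a}" \<beta> s t] by (auto simp: geodesic_segment_def)
  obtain w where w: "w \<in> (\<lambda>s. \<beta> (dist q a - s)) ` {0..dist a q} \<union> \<gamma> ` {0..dist p q}"
      "dist (\<alpha> t) w \<le> \<delta>"
    using slim[OF \<alpha> geodesic_segment_reverse[OF \<beta>] \<gamma>, of t] t by auto
  from w(1) show ?thesis
  proof
    assume "w \<in> (\<lambda>s. \<beta> (dist q a - s)) ` {0..dist a q}"
    then obtain s where s: "w = \<beta> s" "0 \<le> s" "s \<le> dist q a"
      by (force simp: dist_commute)
    have "\<bar>t - s\<bar> \<le> dist p q + \<delta>"
      using w(2) pt \<beta>_dist(1)[OF s(2,3)] s(1) dist_triangle[of p "\<alpha> t" q] dist_triangle[of q "\<alpha> t" w]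
        dist_triangle[of q w p] dist_triangle[of p w "\<alpha> t"]
      by (simp add: dist_commute)
    moreover have "dist w (\<beta> t) = \<bar>t - s\<bar>" using \<beta>_dist(2)[OF s(2,3)] s(1) by simp
    ultimately show ?thesis
      using w(2) dist_triangle[of "\<alpha> t" "\<beta> t" w] zero_le_dist[of p q] by linarith
  next
    assume "w \<in> \<gamma> ` {0..dist p q}"
    then have "dist p w \<le> dist p q"
      using \<gamma> geodesic_on_dist[of "{0..dist p q}" \<gamma> 0] by (auto simp: geodesic_segment_def)
    then have "t \<le> dist p q + \<delta>"
      using w(2) pt dist_triangle[of p "\<alpha> t" w] by (simp add: dist_commute)
    then show ?thesis
      using pt \<beta>_dist(1)[of t] t dist_triangle[of "\<alpha> t" "\<beta> t" p] dist_triangle[of p "\<beta> t" q]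
      by (simp add: dist_commute)
  qed
qed

text \<open>The common end point, or far points on two rays of one class, have a Gromov product
  exceeding \<open>t + \<delta>\<close>. The resulting bound depends on \<delta> only, not on how
  far apart the rays were known to be.\<close>

lemma from_to_close:
  fixes p :: 'a
  assumes g: "geodesic_from_to p c g" "geodesic_from_to p c g'" and c: "c \<in> gromov_carrier"
    and T: "reaches p c T" and t: "0 \<le> t" "t + \<delta> < T"
  shows "dist (g t) (g' t) \<le> 2 * \<delta>"
proof (cases c)
  case (Inl x)
  then show ?thesis
    using g T t fellow_travel[of p x g' x g t] by (simp add: geodesic_from_to_Inl)
next
  case (Inr \<xi>)
  then have rays: "geodesic_ray g" "geodesic_ray g'" and "g 0 = p" "g' 0 = p"
    using g c boundary_ray by auto
  have "asymptotic_rays g g'"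
    using g c Inr boundary_asymptotic by auto
  then obtain M where M: "\<And>t. t \<ge> 0 \<Longrightarrow> dist (g t) (g' t) \<le> M"
    by (auto simp: asymptotic_rays_iff)
  have "0 \<le> M" using M[of 0] zero_le_dist order_trans by blast
  \<comment> \<open>At time \<open>n\<close> the two rays are at most \<open>M\<close> apart, so the
    Gromov product of their points is at least \<open>n - M / 2\<close>, which is more than
    \<open>t + \<delta>\<close>.\<close>
  define n where "n = t + \<delta> + M + 1"
  have n: "0 \<le> n" using t \<delta>_nonneg \<open>0 \<le> M\<close> by (simp add: n_def)
  have "dist p (g n) = n" "dist p (g' n) = n"
    using geodesic_ray_dist[OF rays(1), of 0 n] geodesic_ray_dist[OF rays(2), of 0 n] n
      \<open>g 0 = p\<close> \<open>g' 0 = p\<close> by auto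
  then have "dist (g' t) (g t) \<le> 2 * \<delta>"
    using geodesic_ray_segment[OF rays(1) n] geodesic_ray_segment[OF rays(2) n]
      \<open>g 0 = p\<close> \<open>g' 0 = p\<close> M[OF n] t(1) \<open>0 \<le> M\<close> \<delta>_nonneg
    by (intro fellow_travel[of p "g n" g "g' n"]) (simp_all add: n_def)
  then show ?thesis by (simp add: dist_commute)
qed

section \<open>Convergence to the boundary: change of base point, approximation, sequential
  compactness\<close>

lemma from_to_limit_close:
  fixes p :: 'a
  assumes g: "\<And>n. geodesic_from_to p (c n) (g n)" "\<And>n. geodesic_from_to p (c n) (g' n)"
    and c: "\<And>n. c n \<in> gromov_carrier" and reach: "\<And>T. \<forall>\<^sub>F n in sequentially. reaches p (c n) T"
    and "0 \<le> t"
  shows "\<forall>\<^sub>F n in sequentially. dist (g n t) (g' n t) \<le> 2 * \<delta>"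
  using reach[of "t + \<delta> + 1"]
proof eventually_elim
  case (elim n)
  show ?case by (rule from_to_close[OF g c elim]) (use assms in auto)
qed

text \<open>Otherwise segments of bounded length would subconverge by Arzela-Ascoli to a member of
  \<open>\<xi>\<close>, that is, to a ray, which bounded segments cannot do.\<close>

lemma gromov_converges_reaches:
  fixes p :: 'a
  assumes conv: "gromov_converges p c \<xi>" and \<xi>: "\<xi> \<in> gromov_boundary"
    and c: "\<And>n. c n \<in> gromov_carrier"
  shows "\<forall>\<^sub>F n in sequentially. reaches p (c n) T"
proof (rule ccontr)
  assume "\<not> ?thesis"
  then obtain r :: "nat \<Rightarrow> nat" where r: "strict_mono r" "\<And>n. \<not> reaches p (c (r n)) T"
    by (rule not_eventually_subseq) blast
  obtain g where g: "\<And>n. geodesic_from_to p (c n) (g n)"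
    using gromov_converges_from_to[OF conv] by blast
  obtain s :: "nat \<Rightarrow> nat" and h where s: "strict_mono s" "\<And>t. t \<ge> 0 \<Longrightarrow> (\<lambda>n. g (r (s n)) t) \<longlonglongrightarrow> h t"
    by (rule from_to_subsequence[OF compact_cball g c, of r]) blast
  have "h \<in> \<xi>"
    by (rule gromov_converges_limit[OF conv c g, of "r \<circ> s"]) (use r s in \<open>auto simp: strict_mono_o\<close>)
  then have "\<forall>\<^sub>F n in sequentially. reaches p (c (r (s n))) T"
    using boundary_ray[OF \<xi>]
    by (intro from_to_reaches[of p "\<lambda>n. c (r (s n))" "\<lambda>n. g (r (s n))" h]) (use g c s in auto)
  then have "\<forall>\<^sub>F n::nat in sequentially. False" using r(2) by simp
  then show False by simp
qed

text \<open>A limit of geodesics to \<open>c'\<close> is compared with a limit of geodesics to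
  \<open>c\<close> along a further subsequence; the two stay within \<open>M\<close>, hence in one
  class. One \<open>M\<close> must serve all \<open>t\<close>, while the index from which the bound
  holds may depend on \<open>t\<close>.\<close>

lemma gromov_converges_transfer:
  fixes p q :: 'a
  assumes conv: "gromov_converges p c \<xi>" and \<xi>: "\<xi> \<in> gromov_boundary"
    and c: "\<And>n. c n \<in> gromov_carrier" and c': "\<And>n. c' n \<in> gromov_carrier"
    and ex: "\<And>n. \<exists>g. geodesic_from_to q (c' n) g"
    and reach: "\<And>T. \<forall>\<^sub>F n in sequentially. reaches q (c' n) T"
    and close: "\<And>g g' t. \<lbrakk>\<And>n. geodesic_from_to p (c n) (g n); \<And>n. geodesic_from_to q (c' n) (g' n);
        0 \<le> t\<rbrakk> \<Longrightarrow> \<forall>\<^sub>F n in sequentially. dist (g n t) (g' n t) \<le> M"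
  shows "gromov_converges q c' \<xi>"
  unfolding gromov_converges_iff[of c', OF c']
proof (intro conjI allI impI; (elim conjE)?)
  fix g' r h assume g': "\<forall>n. geodesic_from_to q (c' n) (g' n)" and r: "strict_mono r"
    and h: "\<forall>t\<ge>0. (\<lambda>n. g' (r n) t) \<longlonglongrightarrow> h t"
  obtain g where g: "\<And>n. geodesic_from_to p (c n) (g n)"
    using gromov_converges_from_to[OF conv] by blast
  obtain s :: "nat \<Rightarrow> nat" and k where s: "strict_mono s" and k: "\<And>t. t \<ge> 0 \<Longrightarrow> (\<lambda>n. g (r (s n)) t) \<longlonglongrightarrow> k t"
    by (rule from_to_subsequence[OF compact_cball g c, of r]) blast
  have rs: "strict_mono (r \<circ> s)" using r s by (rule strict_mono_o)
  have "k \<in> \<xi>"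
    by (rule gromov_converges_limit[OF conv c g rs]) (use k in simp)
  have "geodesic_ray h"
    using g' c' h eventually_subseq[OF r reach]
    by (intro from_to_limit_ray(1)[of q "\<lambda>n. c' (r n)" "\<lambda>n. g' (r n)" h]) auto
  moreover have "dist (k t) (h t) \<le> M" if "0 \<le> t" for t
  proof (rule tendsto_upperbound)
    have "(\<lambda>n. g' (r (s n)) t) \<longlonglongrightarrow> h t"
      using LIMSEQ_subseq_LIMSEQ[OF h[rule_format, OF that] s] by (simp add: o_def)
    then show "(\<lambda>n. dist (g (r (s n)) t) (g' (r (s n)) t)) \<longlonglongrightarrow> dist (k t) (h t)"
      by (intro tendsto_dist k that)
    show "\<forall>\<^sub>F n in sequentially. dist (g (r (s n)) t) (g' (r (s n)) t) \<le> M"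
      using eventually_subseq[OF rs close[of g g' t]] g g' that by simp
  qed simp
  ultimately show "h \<in> \<xi>"
    by (rule boundary_mem[OF \<xi> \<open>k \<in> \<xi>\<close>])
qed (rule ex)

text \<open>At each time, any other choice of geodesics to the same points is eventually within
  \<open>2 * \<delta>\<close> of the given one, so all limits are asymptotic to
  \<open>h\<close>.\<close>

lemma gromov_converges_limit_class:
  fixes p :: 'a
  assumes g: "\<And>n. geodesic_from_to p (c n) (g n)" and c: "\<And>n. c n \<in> gromov_carrier"
    and reach: "\<And>T. \<forall>\<^sub>F n in sequentially. reaches p (c n) T"
    and lim: "\<And>t. t \<ge> 0 \<Longrightarrow> (\<lambda>n. g n t) \<longlonglongrightarrow> h t"
  shows "geodesic_ray h" "gromov_converges p c (ray_class h)"
proof -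
  show h: "geodesic_ray h"
    by (rule from_to_limit_ray(1)[OF g c lim reach])
  show "gromov_converges p c (ray_class h)"
    unfolding gromov_converges_iff[of c, OF c]
  proof (intro conjI allI impI; (elim conjE)?)
    fix g' r h' assume g': "\<forall>n. geodesic_from_to p (c n) (g' n)" and r: "strict_mono r"
      and h': "\<forall>t\<ge>0. (\<lambda>n. g' (r n) t) \<longlonglongrightarrow> h' t"
    have "geodesic_ray h'"
      using g' c h' eventually_subseq[OF r reach]
      by (intro from_to_limit_ray(1)[of p "\<lambda>n. c (r n)" "\<lambda>n. g' (r n)" h']) auto
    moreover have "dist (h t) (h' t) \<le> 2 * \<delta>" if "0 \<le> t" for t
    proof (rule tendsto_upperbound)
      have "(\<lambda>n. g (r n) t) \<longlonglongrightarrow> h t"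
        using LIMSEQ_subseq_LIMSEQ[OF lim[OF that] r] by (simp add: o_def)
      then show "(\<lambda>n. dist (g (r n) t) (g' (r n) t)) \<longlonglongrightarrow> dist (h t) (h' t)"
        using h' that by (intro tendsto_dist) auto
      show "\<forall>\<^sub>F n in sequentially. dist (g (r n) t) (g' (r n) t) \<le> 2 * \<delta>"
        using eventually_subseq[OF r from_to_limit_close[of p c g g' t]] g g' c reach that by simp
    qed simp
    ultimately show "h' \<in> ray_class h"
      by (rule boundary_mem[OF ray_class_in_boundary[OF h] ray_class_self[OF h]])
  qed (use g in blast)
qed

lemma ex_from_to_Inl: "\<exists>g. geodesic_from_to p (Inl (x::'a)) g"
proof -
  obtain \<gamma> where "geodesic_segment p x \<gamma>" using ex_segment by blast
  then have "geodesic_from_to p (Inl x) (\<lambda>t. \<gamma> (min t (dist p x)))"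
    by (auto simp: geodesic_from_to.simps(1))
  then show ?thesis by blast
qed

lemma ray_points_reach:
  fixes p :: 'a
  assumes "geodesic_ray \<sigma>"
  shows "\<forall>\<^sub>F n in sequentially. reaches p (Inl (\<sigma> (real n))) T"
proof -
  have "T \<le> dist p (\<sigma> (real n))" if "T + dist p (\<sigma> 0) \<le> real n" for n
    using geodesic_ray_dist[OF assms, of 0 "real n"] that dist_triangle3[of "\<sigma> 0" "\<sigma> (real n)" p]
    by (simp add: dist_commute)
  then show ?thesis
    unfolding reaches_simps by (meson eventually_sequentiallyI order_trans of_nat_le_iff real_arch_simple)
qed

text \<open>Segments from \<open>p\<close> to points of \<open>\<sigma>\<close> fellow-travel
  \<open>\<sigma>\<close>, with a bound that involves only \<delta> and the distance of the origins.
  This supplies an interior sequence for every boundary point.\<close>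

lemma ray_points_converge:
  fixes p :: 'a
  assumes \<sigma>: "geodesic_ray \<sigma>"
  shows "gromov_converges p (\<lambda>n. Inl (\<sigma> (real n))) (ray_class \<sigma>)" (is "gromov_converges p ?c _")
proof (subst gromov_converges_iff, simp, intro conjI allI impI; (elim conjE)?)
  fix g r h assume g: "\<forall>n. geodesic_from_to p (?c n) (g n)" and r: "strict_mono r"
    and h: "\<forall>t\<ge>0. (\<lambda>n. g (r n) t) \<longlonglongrightarrow> h t"
  have "geodesic_ray h"
    using g h eventually_subseq[OF r ray_points_reach[OF \<sigma>, of p]]
    by (intro from_to_limit_ray(1)[of p "\<lambda>n. ?c (r n)" "\<lambda>n. g (r n)" h]) auto
  moreover have "dist (\<sigma> t) (h t) \<le> 3 * dist (\<sigma> 0) p + 2 * \<delta>" if "0 \<le> t" for t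
  proof (rule tendsto_upperbound)
    show "(\<lambda>n. dist (\<sigma> t) (g (r n) t)) \<longlonglongrightarrow> dist (\<sigma> t) (h t)"
      using h that by (intro tendsto_dist) auto
    have ev: "\<forall>\<^sub>F n in sequentially. t \<le> dist q (\<sigma> (real n))" for q
      using ray_points_reach[OF \<sigma>, of q] by simp
    have "\<forall>\<^sub>F n in sequentially. dist (\<sigma> t) (g n t) \<le> 3 * dist (\<sigma> 0) p + 2 * \<delta>"
      using ev[of "\<sigma> 0"] ev[of p]
    proof eventually_elim
      case (elim n)
      show ?case
      proof (rule fellow_travel_bases)
        show "geodesic_segment (\<sigma> 0) (\<sigma> (real n)) \<sigma>"
          using \<sigma> by (simp add: geodesic_ray_segment)
        show "geodesic_segment p (\<sigma> (real n)) (g n)"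
          using g by (simp add: geodesic_from_to_Inl)
      qed (use elim that in auto)
    qed
    then show "\<forall>\<^sub>F n in sequentially. dist (\<sigma> t) (g (r n) t) \<le> 3 * dist (\<sigma> 0) p + 2 * \<delta>"
      by (rule eventually_subseq[OF r])
  qed simp
  ultimately show "h \<in> ray_class \<sigma>"
    by (rule boundary_mem[OF ray_class_in_boundary[OF \<sigma>] ray_class_self[OF \<sigma>]])
qed (rule ex_from_to_Inl)

text \<open>A boundary class contains a ray from \<open>p\<close>: a limit of segments from
  \<open>p\<close> to points running along some representative.\<close>

lemma ex_from_to:
  assumes "c \<in> gromov_carrier"
  shows "\<exists>g. geodesic_from_to (p::'a) c g"
proof (cases c)
  case (Inl x)
  then show ?thesis using ex_from_to_Inl by simp
next
  case (Inr \<xi>)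
  then obtain \<sigma> where \<sigma>: "geodesic_ray \<sigma>" "\<xi> = ray_class \<sigma>"
    using assms by (auto simp: gromov_boundary_def)
  obtain g where g: "\<And>n. geodesic_from_to p (Inl (\<sigma> (real n))) (g n)"
    using gromov_converges_from_to[OF ray_points_converge[OF \<sigma>(1)]] by blast
  obtain r :: "nat \<Rightarrow> nat" and h where r: "strict_mono r" "\<And>t. t \<ge> 0 \<Longrightarrow> (\<lambda>n. g (r n) t) \<longlonglongrightarrow> h t"
    by (rule from_to_subsequence[OF compact_cball g, of id]) auto
  have "h \<in> \<xi>"
    unfolding \<sigma>(2)
    by (rule gromov_converges_limit[OF ray_points_converge[OF \<sigma>(1)] _ g r]) auto
  moreover have "h 0 = p"
  proof -
    have "(\<lambda>n. g (r n) 0) = (\<lambda>_. p)" using from_to_start[OF g] by auto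
    then show ?thesis using r(2)[of 0] by (simp add: LIMSEQ_const_iff)
  qed
  ultimately show ?thesis using Inr by auto
qed

text \<open>Segments with a common end point stay at a distance controlled by that of their origins.
  Needed because the property of \<open>F\<close> is later used at base points other than that of
  the topology.\<close>

lemma gromov_converges_base_change:
  fixes p q :: 'a
  assumes conv: "gromov_converges p (\<lambda>n. Inl (x n)) \<xi>" and \<xi>: "\<xi> \<in> gromov_boundary"
  shows "gromov_converges q (\<lambda>n. Inl (x n)) \<xi>"
proof (rule gromov_converges_transfer[OF conv \<xi>])
  have reach: "\<forall>\<^sub>F n in sequentially. T \<le> dist p (x n)" for T
    using gromov_converges_reaches[OF conv \<xi>] by simp
  have reach': "\<forall>\<^sub>F n in sequentially. T \<le> dist q (x n)" for T
    using reach[of "T + dist p q"]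
  proof eventually_elim
    case (elim n)
    then show ?case using dist_triangle[of p "x n" q] by simp
  qed
  then show "\<forall>\<^sub>F n in sequentially. reaches q (Inl (x n)) T" for T by simp
  fix g g' and t :: real assume g: "\<And>n. geodesic_from_to p (Inl (x n)) (g n)"
    "\<And>n. geodesic_from_to q (Inl (x n)) (g' n)" and "0 \<le> t"
  show "\<forall>\<^sub>F n in sequentially. dist (g n t) (g' n t) \<le> 3 * dist p q + 2 * \<delta>"
    using reach[of t] reach'[of t]
  proof eventually_elim
    case (elim n)
    show ?case
      by (rule fellow_travel_bases[of p "x n" "g n" q "g' n"])
        (use g \<open>0 \<le> t\<close> elim in \<open>auto simp: geodesic_from_to_Inl\<close>)
  qed
qed (auto intro: ex_from_to_Inl)

text \<open>Boundary entries are replaced by points on the chosen rays \<open>g n\<close>, at times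
  at least \<open>n\<close> so that they escape. The bound \<open>4 * \<delta>\<close> comes from
  comparing through \<open>g\<close>: two geodesics to \<open>c n\<close>, then two segments to
  \<open>y n\<close>.\<close>

lemma gromov_converges_interior_approx:
  fixes p :: 'a
  assumes conv: "gromov_converges p c \<xi>" and \<xi>: "\<xi> \<in> gromov_boundary"
    and c: "\<And>n. c n \<in> gromov_carrier" and g: "\<And>n. geodesic_from_to p (c n) (g n)"
    and y: "\<And>n. c n = Inl (y n) \<or> (\<exists>\<zeta> s. c n = Inr \<zeta> \<and> real n \<le> s \<and> y n = g n s)"
  shows "gromov_converges p (\<lambda>n. Inl (y n)) \<xi>"
proof (rule gromov_converges_transfer[OF conv \<xi> c])
  have seg: "geodesic_segment p (y n) (g n)" for n
    using y[of n]
  proof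
    assume "c n = Inl (y n)"
    then show ?thesis using g[of n] by (simp add: geodesic_from_to_Inl)
  next
    assume "\<exists>\<zeta> s. c n = Inr \<zeta> \<and> real n \<le> s \<and> y n = g n s"
    then obtain \<zeta> s where s: "c n = Inr \<zeta>" "real n \<le> s" "y n = g n s" by blast
    then have "geodesic_ray (g n)" "g n 0 = p"
      using c[of n] g[of n] boundary_ray by auto
    then show ?thesis using geodesic_ray_segment[of "g n" s] s of_nat_0_le_iff[of n] by auto
  qed
  have far: "\<forall>\<^sub>F n in sequentially. T \<le> dist p (y n)" for T
    using gromov_converges_reaches[OF conv \<xi> c, of T] eventually_ge_at_top[of "nat \<lceil>T\<rceil>"]
  proof eventually_elim
    case (elim n)
    from y[of n] show ?case
    proof
      assume "c n = Inl (y n)"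
      then show ?thesis using elim by simp
    next
      assume "\<exists>\<zeta> s. c n = Inr \<zeta> \<and> real n \<le> s \<and> y n = g n s"
      then obtain \<zeta> s where s: "c n = Inr \<zeta>" "real n \<le> s" "y n = g n s" by blast
      then have "geodesic_ray (g n)" "g n 0 = p"
        using c[of n] g[of n] boundary_ray by auto
      then have "dist p (y n) = s" using geodesic_ray_dist[of "g n" 0 s] s of_nat_0_le_iff[of n] by auto
      then show ?thesis using elim(2) s(2) by linarith
    qed
  qed
  then show "\<forall>\<^sub>F n in sequentially. reaches p (Inl (y n)) T" for T by simp
  fix k g' and t :: real assume k: "\<And>n. geodesic_from_to p (c n) (k n)"
    and g': "\<And>n. geodesic_from_to p (Inl (y n)) (g' n)" and "0 \<le> t"
  show "\<forall>\<^sub>F n in sequentially. dist (k n t) (g' n t) \<le> 4 * \<delta>"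
    using from_to_limit_close[OF k g c gromov_converges_reaches[OF conv \<xi> c] \<open>0 \<le> t\<close>]
      far[of "t + \<delta> + 1"]
  proof eventually_elim
    case (elim n)
    have "dist (g n t) (g' n t) \<le> 2 * \<delta>"
      by (rule fellow_travel[of p "y n" "g' n" "y n" "g n"])
        (use g'[of n] seg \<open>0 \<le> t\<close> elim in \<open>auto simp: geodesic_from_to_Inl\<close>)
    then show ?case using elim(1) dist_triangle[of "k n t" "g' n t" "g n t"] by linarith
  qed
qed (auto intro: ex_from_to_Inl)

text \<open>Either the geodesics become arbitrarily long and Arzela-Ascoli yields a limit ray, or
  infinitely many entries lie in one closed ball, which is compact.\<close>

lemma gromov_carrier_seq_compact:
  fixes p :: 'a
  assumes c: "\<And>n::nat. c n \<in> gromov_carrier"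
  obtains (interior) r :: "nat \<Rightarrow> nat" and x y where "strict_mono r" "\<And>n. c (r n) = Inl (y n)" "y \<longlonglongrightarrow> x"
    | (boundary) r :: "nat \<Rightarrow> nat" and \<xi> where "strict_mono r" "\<xi> \<in> gromov_boundary" "gromov_converges p (c \<circ> r) \<xi>"
proof (cases "\<forall>T. \<forall>\<^sub>F n in sequentially. reaches p (c n) T")
  case True
  obtain g where g: "\<And>n. geodesic_from_to p (c n) (g n)"
    using ex_from_to[OF c] by metis
  obtain r :: "nat \<Rightarrow> nat" and h where r: "strict_mono r" "\<And>t. t \<ge> 0 \<Longrightarrow> (\<lambda>n. g (r n) t) \<longlonglongrightarrow> h t"
    by (rule from_to_subsequence[OF compact_cball g c, of id]) auto
  have reach: "\<forall>\<^sub>F n in sequentially. reaches p ((c \<circ> r) n) T" for T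
    using eventually_subseq[OF r(1), of "\<lambda>n. reaches p (c n) T"] True by simp
  have *: "\<And>n. geodesic_from_to p ((c \<circ> r) n) (g (r n))" "\<And>n. (c \<circ> r) n \<in> gromov_carrier"
    using g c by auto
  show ?thesis
    using boundary[OF r(1) ray_class_in_boundary] gromov_converges_limit_class[OF * reach r(2)] by blast
next
  case False
  then obtain T and r :: "nat \<Rightarrow> nat" where r: "strict_mono r" "\<And>n. \<not> reaches p (c (r n)) T"
    by (metis not_eventually_subseq)
  \<comment> \<open>Boundary points are reached at every length, so all these entries are
    interior.\<close>
  have "\<exists>y. c (r n) = Inl y \<and> y \<in> cball p T" for n
    using r(2)[of n] by (cases "c (r n)") auto
  then obtain y where y: "\<And>n. c (r n) = Inl (y n)" "\<And>n. y n \<in> cball p T"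
    by metis
  have "seq_compact (cball p T)" by (rule compact_imp_seq_compact[OF compact_cball])
  then obtain x and s :: "nat \<Rightarrow> nat" where s: "strict_mono s" "(y \<circ> s) \<longlonglongrightarrow> x"
    unfolding seq_compact_def using y(2) by metis
  show ?thesis
    by (rule interior[of "r \<circ> s" "y \<circ> s" x]) (use r s y in \<open>auto simp: strict_mono_o\<close>)
qed

end

section \<open>Busemann functions\<close>

text \<open>By the triangle inequality \<open>dist z (\<gamma> t) - t\<close> is nonincreasing and
  bounded below, hence converges. This existence result gives the \<open>Lim\<close> in the
  definition its meaning.\<close>

lemma busemann_tendsto:
  assumes \<gamma>: "geodesic_ray \<gamma>"
  shows "((\<lambda>t. dist x (\<gamma> t) - dist (\<gamma> t) y) \<longlongrightarrow> busemann \<gamma> x y) at_top"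
proof -
  have ex: "\<exists>L. ((\<lambda>t. dist z (\<gamma> t) - t) \<longlongrightarrow> L) at_top" for z
  proof -
    define f where "f t = dist z (\<gamma> t) - t" for t
    have mono: "f t \<le> f s" if "0 \<le> s" "s \<le> t" for s t
      using dist_triangle[of z "\<gamma> t" "\<gamma> s"] geodesic_ray_dist[OF \<gamma>, of s t] that by (simp add: f_def)
    have lower: "- dist z (\<gamma> 0) \<le> f t" if "0 \<le> t" for t
      using dist_triangle3[of "\<gamma> 0" "\<gamma> t" z] geodesic_ray_dist[OF \<gamma>, of 0 t] that by (simp add: f_def)
    have bdd: "bdd_below (f ` {0..})" using lower by (intro bdd_belowI2) auto
    have "(f \<longlongrightarrow> Inf (f ` {0..})) at_top"
    proof (rule order_tendstoI)
      fix a assume "a < Inf (f ` {0..})"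
      then have "a < f t" if "0 \<le> t" for t
        using cInf_lower[OF _ bdd, of "f t"] that by fastforce
      then show "\<forall>\<^sub>F t in at_top. a < f t"
        using eventually_ge_at_top[of 0] by (rule eventually_mono[rotated])
    next
      fix a assume "Inf (f ` {0..}) < a"
      then obtain s where s: "0 \<le> s" "f s < a" using cInf_lessD[of "f ` {0..}" a] by auto
      have "f t < a" if "s \<le> t" for t using mono[OF s(1) that] s(2) by simp
      then show "\<forall>\<^sub>F t in at_top. f t < a"
        using eventually_ge_at_top[of s] by (rule eventually_mono[rotated])
    qed
    then show ?thesis unfolding f_def by blast
  qed
  obtain L M where "((\<lambda>t. dist x (\<gamma> t) - t) \<longlongrightarrow> L) at_top" "((\<lambda>t. dist y (\<gamma> t) - t) \<longlongrightarrow> M) at_top"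
    using ex by blast
  then have "((\<lambda>t. dist x (\<gamma> t) - dist (\<gamma> t) y) \<longlongrightarrow> L - M) at_top"
    using tendsto_diff by (fastforce simp: dist_commute)
  then show ?thesis
    unfolding busemann_def using tendsto_Lim[OF trivial_limit_at_top_linorder] by metis
qed

lemma busemann_add:
  assumes "geodesic_ray \<gamma>"
  shows "busemann \<gamma> x z = busemann \<gamma> x y + busemann \<gamma> y z"
  using tendsto_unique[OF trivial_limit_at_top_linorder busemann_tendsto[OF assms, of x z]]
    tendsto_add[OF busemann_tendsto[OF assms, of x y] busemann_tendsto[OF assms, of y z]]
  by (simp add: dist_commute)

lemma busemann_self: "geodesic_ray \<gamma> \<Longrightarrow> busemann \<gamma> x x = 0"
  using busemann_add[of \<gamma> x x x] by simp

lemma busemann_swap: "geodesic_ray \<gamma> \<Longrightarrow> busemann \<gamma> x y = - busemann \<gamma> y x"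
  using busemann_add[of \<gamma> x x y] busemann_self[of \<gamma> x] by simp

lemma busemann_le_dist:
  assumes "geodesic_ray \<gamma>"
  shows "busemann \<gamma> x y \<le> dist x y"
proof (rule tendsto_upperbound[OF busemann_tendsto[OF assms]])
  show "\<forall>\<^sub>F t in at_top. dist x (\<gamma> t) - dist (\<gamma> t) y \<le> dist x y"
    by (rule always_eventually, rule allI) metric
qed simp

text \<open>Distances along a ray are exact. The value shows that Busemann functions are unbounded
  below, and it drives the proof of injectivity.\<close>

lemma busemann_ray:
  assumes \<gamma>: "geodesic_ray \<gamma>" and "0 \<le> s"
  shows "busemann \<gamma> (\<gamma> s) (\<gamma> 0) = - s"
proof -
  have "\<forall>\<^sub>F t in at_top. dist (\<gamma> s) (\<gamma> t) - dist (\<gamma> t) (\<gamma> 0) = - s"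
    using eventually_ge_at_top[of s]
  proof eventually_elim
    case (elim t)
    then show ?case
      using geodesic_ray_dist[OF \<gamma>, of s t] geodesic_ray_dist[OF \<gamma>, of t 0] \<open>0 \<le> s\<close> by simp
  qed
  then have "((\<lambda>t. dist (\<gamma> s) (\<gamma> t) - dist (\<gamma> t) (\<gamma> 0)) \<longlongrightarrow> - s) at_top"
    by (rule tendsto_eventually)
  then show ?thesis
    using tendsto_unique[OF trivial_limit_at_top_linorder busemann_tendsto[OF \<gamma>]] by blast
qed

lemma busemann_sequentially:
  "geodesic_ray \<gamma> \<Longrightarrow> (\<lambda>n. dist x (\<gamma> (real n)) - dist (\<gamma> (real n)) y) \<longlonglongrightarrow> busemann \<gamma> x y"
  by (rule filterlim_compose[OF busemann_tendsto filterlim_real_sequentially])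

text \<open>Distance functions are 1-Lipschitz, and a shift of time does not change a limit at
  infinity.\<close>

lemma busemann_strongly_asymptotic:
  assumes \<gamma>: "geodesic_ray \<gamma>" and \<sigma>: "geodesic_ray \<sigma>" and s: "strongly_asymptotic_rays \<gamma> \<sigma>"
  shows "busemann \<gamma> x y = busemann \<sigma> x y"
proof -
  obtain T where T: "((\<lambda>t. dist (\<gamma> t) (\<sigma> (t + T))) \<longlongrightarrow> 0) at_top"
    using s by (auto simp: strongly_asymptotic_rays_def)
  let ?f = "\<lambda>t. dist x (\<gamma> t) - dist (\<gamma> t) y" and ?g = "\<lambda>t. dist x (\<sigma> t) - dist (\<sigma> t) y"
  have shift: "filterlim (\<lambda>t::real. t + T) at_top at_top"
    using filterlim_tendsto_add_at_top[OF tendsto_const[of T] filterlim_ident] by (simp add: add.commute)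
  have g: "((\<lambda>t. ?g (t + T)) \<longlongrightarrow> busemann \<sigma> x y) at_top"
    by (rule filterlim_compose[OF busemann_tendsto[OF \<sigma>] shift])
  have diff: "((\<lambda>t. ?f t - ?g (t + T)) \<longlongrightarrow> 0) at_top"
  proof (rule Lim_null_comparison)
    show "\<forall>\<^sub>F t in at_top. norm (?f t - ?g (t + T)) \<le> 2 * dist (\<gamma> t) (\<sigma> (t + T))"
    proof (rule always_eventually, rule allI)
      fix t
      have "\<bar>dist x (\<gamma> t) - dist x (\<sigma> (t + T))\<bar> \<le> dist (\<gamma> t) (\<sigma> (t + T))"
        "\<bar>dist (\<sigma> (t + T)) y - dist (\<gamma> t) y\<bar> \<le> dist (\<gamma> t) (\<sigma> (t + T))"
        by metric+
      then show "norm (?f t - ?g (t + T)) \<le> 2 * dist (\<gamma> t) (\<sigma> (t + T))" by simp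
    qed
    show "((\<lambda>t. 2 * dist (\<gamma> t) (\<sigma> (t + T))) \<longlongrightarrow> 0) at_top"
      using tendsto_mult[OF tendsto_const[of 2] T] by simp
  qed
  have "(?f \<longlongrightarrow> busemann \<sigma> x y) at_top"
    using tendsto_add[OF diff g] by simp
  then show ?thesis
    using tendsto_unique[OF trivial_limit_at_top_linorder busemann_tendsto[OF \<gamma>]] by blast
qed

text \<open>The representative of \<open>gromov_to_horo c\<close> that vanishes at \<open>p\<close>.\<close>

definition horo_fun :: "'a::metric_space \<Rightarrow> 'a + (real \<Rightarrow> 'a) set \<Rightarrow> 'a \<Rightarrow> real" where
  "horo_fun p c y =
     (case c of Inl x \<Rightarrow> dist y x - dist p x | Inr \<xi> \<Rightarrow> busemann (SOME \<gamma>. \<gamma> \<in> \<xi>) y p)"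

lemma horo_fun_Inl [simp]: "horo_fun p (Inl x) y = dist y x - dist p x"
  by (simp add: horo_fun_def)

lemma boundary_some: "\<xi> \<in> gromov_boundary \<Longrightarrow> (SOME \<gamma>. \<gamma> \<in> \<xi>) \<in> \<xi>"
  using someI_ex[OF boundary_nonempty] .

lemma boundary_some_ray: "\<xi> \<in> gromov_boundary \<Longrightarrow> geodesic_ray (SOME \<gamma>. \<gamma> \<in> \<xi>)"
  by (rule boundary_ray[OF _ boundary_some])

lemma horo_fun_base: "c \<in> gromov_carrier \<Longrightarrow> horo_fun p c p = 0"
  by (cases c) (auto simp: horo_fun_def busemann_self boundary_some_ray)

lemma horo_fun_lipschitz:
  assumes c: "c \<in> gromov_carrier"
  shows "dist (horo_fun p c y) (horo_fun p c z) \<le> dist y z"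
proof -
  have "horo_fun p c y - horo_fun p c z \<le> dist y z" for y z
  proof (cases c)
    case (Inl x)
    then show ?thesis using dist_triangle[of y x z] by simp
  next
    case (Inr \<xi>)
    then have ray: "geodesic_ray (SOME \<gamma>. \<gamma> \<in> \<xi>)" using boundary_some_ray c by simp
    show ?thesis
      using busemann_add[OF ray, of y p z] busemann_le_dist[OF ray, of y z] Inr by (simp add: horo_fun_def)
  qed
  from this[of y z] this[of z y] show ?thesis by (simp add: dist_real_def abs_le_iff dist_commute)
qed

lemma horo_fun_continuous:
  assumes "c \<in> gromov_carrier"
  shows "continuous_on UNIV (horo_fun p c)"
  by (rule lipschitz_on_continuous_on[of 1])
    (use horo_fun_lipschitz[OF assms] in \<open>auto simp: lipschitz_on_def\<close>)

section \<open>Normalization of classes at a base point\<close>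

lemma fun_class_eq_iff: "fun_class f = fun_class g \<longleftrightarrow> (\<forall>x. f x - f p = g x - g p)"
proof
  assume "fun_class f = fun_class g"
  moreover have "f \<in> fun_class f" by (auto simp: fun_class_def intro: exI[of _ 0])
  ultimately have "f \<in> fun_class g" by simp
  then show "\<forall>x. f x - f p = g x - g p" by (auto simp: fun_class_def)
next
  assume *: "\<forall>x. f x - f p = g x - g p"
  have "fun_class f \<subseteq> fun_class g" if "\<forall>x. f x - f p = g x - g p" for f g :: "'a \<Rightarrow> real"
  proof
    fix h assume "h \<in> fun_class f"
    then obtain c where "\<forall>x. h x = f x + c" by (auto simp: fun_class_def)
    then have "\<forall>x. h x = g x + (f p - g p + c)" using that by (smt (verit))
    then show "h \<in> fun_class g" unfolding fun_class_def by blast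
  qed
  then show "fun_class f = fun_class g" using * by (simp add: subset_antisym)
qed

text \<open>By the cocycle identity, moving the second argument of a Busemann function from
  \<open>\<gamma> 0\<close> to \<open>p\<close> only adds a constant.\<close>

lemma gromov_to_horo_eq:
  assumes "c \<in> gromov_carrier"
  shows "gromov_to_horo c = fun_class (horo_fun p c)"
proof (cases c)
  case (Inl x)
  then show ?thesis by (simp add: fun_class_eq_iff[of _ _ p])
next
  case (Inr \<xi>)
  define \<gamma> where "\<gamma> = (SOME \<gamma>. \<gamma> \<in> \<xi>)"
  have ray: "geodesic_ray \<gamma>" using boundary_some_ray assms Inr by (simp add: \<gamma>_def)
  have "gromov_to_horo c = fun_class (\<lambda>x. busemann \<gamma> x (\<gamma> 0))" using Inr by (simp add: \<gamma>_def Let_def)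
  also have "\<dots> = fun_class (\<lambda>x. busemann \<gamma> x p)"
    unfolding fun_class_eq_iff[of _ _ p]
  proof
    fix x
    show "busemann \<gamma> x (\<gamma> 0) - busemann \<gamma> p (\<gamma> 0) = busemann \<gamma> x p - busemann \<gamma> p p"
      using busemann_add[OF ray, of x "\<gamma> 0" p] busemann_self[OF ray, of p] by simp
  qed
  finally show ?thesis using Inr by (simp add: horo_fun_def[abs_def] \<gamma>_def)
qed

section \<open>Busemann functions under the weak approaching geodesics property\<close>

locale approaching_space = hyperbolic_space \<delta> X
  for \<delta> :: real and X :: "'a::metric_space itself" +
  fixes F :: "(real \<Rightarrow> 'a) set"
  assumes F_rays: "\<And>\<gamma>. \<gamma> \<in> F \<Longrightarrow> geodesic_ray \<gamma>"
    and approaching: "weak_approaching_geodesics F"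
begin

lemma F_limit:
  assumes conv: "gromov_converges p (\<lambda>n. Inl (x n)) \<xi>" and \<xi>: "\<xi> \<in> gromov_boundary"
  obtains r g h where "strict_mono r" "\<And>k. geodesic_from_to p (Inl (x (r k))) (g k)" "h \<in> F" "h \<in> \<xi>"
    "h 0 = p" "\<And>t. 0 \<le> t \<Longrightarrow> (\<lambda>k. g k t) \<longlonglongrightarrow> h t"
proof -
  have "\<exists>r g. strict_mono r \<and> (\<forall>k. geodesic_from_to p (Inl (x (r k))) (g k)) \<and>
      (\<exists>h\<in>F. geodesic_ray h \<and> locally_uniform_limit g h)"
    using approaching conv \<xi> unfolding weak_approaching_geodesics_def o_def by blast
  then obtain r g h where r: "strict_mono r" and g: "\<And>k. geodesic_from_to p (Inl (x (r k))) (g k)"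
    and h: "h \<in> F" "locally_uniform_limit g h" by blast
  have lim: "(\<lambda>k. g k t) \<longlonglongrightarrow> h t" if "0 \<le> t" for t
    using h(2) locally_uniform_limit_from_to[of p "\<lambda>k. Inl (x (r k))" g h] g that by simp
  have "gromov_converges p (\<lambda>k. Inl (x (r k))) \<xi>"
    using gromov_converges_subseq[OF conv r] by (simp add: o_def)
  then have "h \<in> \<xi>"
    by (rule gromov_converges_limit[of _ _ _ g id]) (use g lim in \<open>auto simp: strict_mono_def\<close>)
  moreover have "h 0 = p"
  proof -
    have "(\<lambda>k. g k 0) = (\<lambda>_. p)" using from_to_start[OF g] by auto
    then show ?thesis using lim[of 0] by (simp add: LIMSEQ_const_iff)
  qed
  ultimately show ?thesis using that r g h(1) lim by blast
qed

lemma F_meets_class: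
  assumes \<xi>: "\<xi> \<in> gromov_boundary"
  obtains \<sigma> where "\<sigma> \<in> F" "\<sigma> \<in> \<xi>"
proof -
  obtain \<gamma> where \<gamma>: "\<xi> = ray_class \<gamma>" "geodesic_ray \<gamma>" using \<xi> by (auto simp: gromov_boundary_def)
  show ?thesis
    by (rule F_limit[OF ray_points_converge[OF \<gamma>(2), of "\<gamma> 0"]])
      (use \<gamma> ray_class_in_boundary that in auto)
qed

lemma busemann_F_eq:
  assumes "\<xi> \<in> gromov_boundary" "\<sigma> \<in> F" "\<sigma> \<in> \<xi>" "\<tau> \<in> F" "\<tau> \<in> \<xi>"
  shows "busemann \<sigma> x y = busemann \<tau> x y"
proof (rule busemann_strongly_asymptotic)
  show "strongly_asymptotic_rays \<sigma> \<tau>"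
    using approaching boundary_asymptotic[OF assms(1,3,5)] assms(2,4)
    unfolding weak_approaching_geodesics_def by blast
qed (use assms F_rays in auto)

text \<open>Segments issuing from \<open>q\<close> itself give the upper bound for the difference of distances to \<open>y\<close>
  and \<open>q\<close>; exchanging \<open>y\<close> and \<open>q\<close> turns it into the lower bound.\<close>

lemma eventually_less_busemann:
  fixes q y :: 'a
  assumes conv: "gromov_converges q (\<lambda>n. Inl (x n)) \<xi>" and \<xi>: "\<xi> \<in> gromov_boundary"
    and \<sigma>: "\<sigma> \<in> F" "\<sigma> \<in> \<xi>" and "0 < \<epsilon>"
  shows "\<forall>\<^sub>F n in sequentially. dist y (x n) - dist q (x n) < busemann \<sigma> y q + \<epsilon>"
proof (rule ccontr)
  assume "\<not> ?thesis"
  then obtain r :: "nat \<Rightarrow> nat" where r: "strict_mono r"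
    and large: "\<And>n. \<not> dist y (x (r n)) - dist q (x (r n)) < busemann \<sigma> y q + \<epsilon>"
    by (rule not_eventually_subseq) blast
  have conv_r: "gromov_converges q (\<lambda>n. Inl (x (r n))) \<xi>"
    using gromov_converges_subseq[OF conv r] by (simp add: o_def)
  obtain s g h where s: "strict_mono s" and g: "\<And>k. geodesic_from_to q (Inl (x (r (s k)))) (g k)"
    and h: "h \<in> F" "h \<in> \<xi>" "h 0 = q" and lim: "\<And>t. 0 \<le> t \<Longrightarrow> (\<lambda>k. g k t) \<longlonglongrightarrow> h t"
    by (rule F_limit[OF conv_r \<xi>]) blast
  have ray: "geodesic_ray h" using F_rays h(1) .
  \<comment> \<open>The time \<open>t\<close> is fixed before \<open>k\<close>, using up half of
    \<epsilon>; the other half is left for the distance from \<open>g k t\<close> to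
    \<open>h t\<close>.\<close>
  have "\<forall>\<^sub>F t in at_top. dist y (h t) - dist (h t) q < busemann h y q + \<epsilon> / 2"
    by (rule order_tendstoD(2)[OF busemann_tendsto[OF ray]]) (use \<open>0 < \<epsilon>\<close> in simp)
  then have "\<forall>\<^sub>F t in at_top. 0 \<le> t \<and> dist y (h t) - dist (h t) q < busemann h y q + \<epsilon> / 2"
    by (intro eventually_conj eventually_ge_at_top)
  then obtain t where t: "0 \<le> t" "dist y (h t) - dist (h t) q < busemann h y q + \<epsilon> / 2"
    using eventually_happens'[OF trivial_limit_at_top_linorder] by blast
  have "dist (h t) q = t" using geodesic_ray_dist[OF ray, of t 0] t(1) h(3) by simp
  have ev: "\<forall>\<^sub>F k in sequentially. dist (g k t) (h t) < \<epsilon> / 2"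
    using lim[OF t(1)] \<open>0 < \<epsilon>\<close> by (intro tendstoD) auto
  have "\<forall>\<^sub>F k in sequentially. t \<le> dist q (x (r (s k)))"
    using gromov_converges_reaches[OF conv_r \<xi>, of t] eventually_subseq[OF s, of "\<lambda>k. t \<le> dist q (x (r k))"]
    by simp
  with ev have "\<forall>\<^sub>F k::nat in sequentially. False"
  proof eventually_elim
    case (elim k)
    have "dist (g k t) (x (r (s k))) = dist q (x (r (s k))) - t"
      using g[of k] t(1) elim(2) geodesic_on_dist[of "{0..dist q (x (r (s k)))}" "g k" t "dist q (x (r (s k)))"]
      by (auto simp: geodesic_from_to_Inl geodesic_segment_def)
    \<comment> \<open>Going from \<open>y\<close> to \<open>g k t\<close>, the remaining way along
      the segment is shorter by \<open>t\<close> than the whole way from \<open>q\<close>.\<close>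
    then have "dist y (x (r (s k))) - dist q (x (r (s k))) \<le> dist y (g k t) - t"
      using dist_triangle[of y "x (r (s k))" "g k t"] by simp
    also have "\<dots> < dist y (h t) + \<epsilon> / 2 - t"
      using dist_triangle[of y "g k t" "h t"] elim(1) by (simp add: dist_commute)
    also have "\<dots> < busemann h y q + \<epsilon>"
      using t(2) \<open>dist (h t) q = t\<close> by simp
    also have "busemann h y q = busemann \<sigma> y q"
      by (rule busemann_F_eq[OF \<xi>]) (use h \<sigma> in auto)
    finally show ?case using large[of "s k"] by blast
  qed
  then show False by simp
qed

lemma interior_tendsto_busemann_F:
  fixes q y :: 'a
  assumes conv: "gromov_converges p (\<lambda>n. Inl (x n)) \<xi>" and \<xi>: "\<xi> \<in> gromov_boundary"
    and \<sigma>: "\<sigma> \<in> F" "\<sigma> \<in> \<xi>"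
  shows "(\<lambda>n. dist y (x n) - dist q (x n)) \<longlonglongrightarrow> busemann \<sigma> y q"
proof (rule order_tendstoI)
  note up = eventually_less_busemann[OF gromov_converges_base_change[OF conv \<xi>] \<xi> \<sigma>]
  fix a assume "a < busemann \<sigma> y q"
  \<comment> \<open>The upper bound with \<open>y\<close> and \<open>q\<close> exchanged, seen from
    the base point \<open>y\<close>, with the gap above \<open>a\<close> as \<epsilon>.\<close>
  then have "\<forall>\<^sub>F n in sequentially. dist q (x n) - dist y (x n) < busemann \<sigma> q y + (busemann \<sigma> y q - a)"
    by (intro up) simp
  then show "\<forall>\<^sub>F n in sequentially. a < dist y (x n) - dist q (x n)"
  proof eventually_elim
    case (elim n)
    then show ?case using busemann_swap[OF F_rays[OF \<sigma>(1)], of q y] by linarith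
  qed
next
  note up = eventually_less_busemann[OF gromov_converges_base_change[OF conv \<xi>] \<xi> \<sigma>]
  fix a assume "busemann \<sigma> y q < a"
  then show "\<forall>\<^sub>F n in sequentially. dist y (x n) - dist q (x n) < a"
    using up[of "a - busemann \<sigma> y q" y q] by simp
qed

text \<open>Along the points of any ray of the class, the differences of distances converge both to
  its own Busemann function and to that of a ray of \<open>F\<close>. Hence the choice of a
  representative is immaterial.\<close>

lemma busemann_class_eq:
  fixes x y :: 'a
  assumes \<xi>: "\<xi> \<in> gromov_boundary" and "\<gamma> \<in> \<xi>" "\<gamma>' \<in> \<xi>"
  shows "busemann \<gamma> x y = busemann \<gamma>' x y"
proof -
  obtain \<sigma> where \<sigma>: "\<sigma> \<in> F" "\<sigma> \<in> \<xi>" using F_meets_class[OF \<xi>] .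
  have "busemann \<gamma> x y = busemann \<sigma> x y" if "\<gamma> \<in> \<xi>" for \<gamma>
  proof -
    have ray: "geodesic_ray \<gamma>" using boundary_ray[OF \<xi> that] .
    have "gromov_converges x (\<lambda>n. Inl (\<gamma> (real n))) \<xi>"
      using ray_points_converge[OF ray] ray_class_eq[OF \<xi> that] by simp
    from interior_tendsto_busemann_F[OF this \<xi> \<sigma>, of x y] show ?thesis
      using LIMSEQ_unique busemann_sequentially[OF ray, of x y] by (simp add: dist_commute)
  qed
  with assms show ?thesis by metis
qed

lemma horo_fun_Inr:
  fixes p y :: 'a
  assumes "\<xi> \<in> gromov_boundary" "\<gamma> \<in> \<xi>"
  shows "horo_fun p (Inr \<xi>) y = busemann \<gamma> y p"
  unfolding horo_fun_def sum.case by (intro busemann_class_eq[of \<xi>] boundary_some assms)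

text \<open>Each boundary entry is replaced by a point far out on its ray, where the difference of
  distances nearly equals the Busemann function. The replacement depends on \<open>y\<close>, which
  is harmless for a pointwise limit.\<close>

lemma horo_fun_tendsto:
  fixes p y :: 'a
  assumes conv: "gromov_converges p c \<xi>" and \<xi>: "\<xi> \<in> gromov_boundary"
    and c: "\<And>n. c n \<in> gromov_carrier"
  shows "(\<lambda>n. horo_fun p (c n) y) \<longlonglongrightarrow> horo_fun p (Inr \<xi>) y"
proof -
  obtain g where g: "\<And>n. geodesic_from_to p (c n) (g n)"
    using gromov_converges_from_to[OF conv] by blast
  have "\<exists>z. (c n = Inl z \<or> (\<exists>\<zeta> s. c n = Inr \<zeta> \<and> real n \<le> s \<and> z = g n s)) \<and>
      \<bar>dist y z - dist p z - horo_fun p (c n) y\<bar> < inverse (real (Suc n))" for n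
  proof (cases "c n")
    case (Inl z)
    then show ?thesis by auto
  next
    case (Inr \<zeta>)
    then have \<zeta>: "\<zeta> \<in> gromov_boundary" "g n \<in> \<zeta>" using c[of n] g[of n] by auto
    then have ray: "geodesic_ray (g n)" by (rule boundary_ray)
    have "\<forall>\<^sub>F s in at_top. dist (dist y (g n s) - dist (g n s) p) (busemann (g n) y p) < inverse (real (Suc n))"
      by (rule tendstoD[OF busemann_tendsto[OF ray]]) simp
    then have "\<forall>\<^sub>F s in at_top. real n \<le> s \<and>
        dist (dist y (g n s) - dist (g n s) p) (busemann (g n) y p) < inverse (real (Suc n))"
      by (intro eventually_conj eventually_ge_at_top)
    then obtain s where s: "real n \<le> s"
        "dist (dist y (g n s) - dist (g n s) p) (busemann (g n) y p) < inverse (real (Suc n))"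
      using eventually_happens'[OF trivial_limit_at_top_linorder] by blast
    then show ?thesis
      using Inr horo_fun_Inr[OF \<zeta>] by (intro exI[of _ "g n s"]) (auto simp: dist_real_def dist_commute)
  qed
  then obtain z where z: "\<And>n. c n = Inl (z n) \<or> (\<exists>\<zeta> s. c n = Inr \<zeta> \<and> real n \<le> s \<and> z n = g n s)"
    and close: "\<And>n. \<bar>dist y (z n) - dist p (z n) - horo_fun p (c n) y\<bar> < inverse (real (Suc n))"
    by metis
  obtain \<sigma> where \<sigma>: "\<sigma> \<in> F" "\<sigma> \<in> \<xi>" using F_meets_class[OF \<xi>] .
  have lim: "(\<lambda>n. dist y (z n) - dist p (z n)) \<longlonglongrightarrow> horo_fun p (Inr \<xi>) y"
    unfolding horo_fun_Inr[OF \<xi> \<sigma>(2)]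
    by (rule interior_tendsto_busemann_F[OF gromov_converges_interior_approx[OF conv \<xi> c g z] \<xi> \<sigma>])
  have "(\<lambda>n. (dist y (z n) - dist p (z n)) - horo_fun p (c n) y) \<longlonglongrightarrow> 0"
    by (rule Lim_null_comparison[OF always_eventually LIMSEQ_inverse_real_of_nat])
      (use close less_imp_le in \<open>auto simp del: of_nat_Suc\<close>)
  from tendsto_diff[OF lim this] show ?thesis by simp
qed

lemma horo_fun_inj:
  fixes p :: 'a
  assumes c: "c \<in> gromov_carrier" "c' \<in> gromov_carrier" and eq: "\<And>y. horo_fun p c y = horo_fun p c' y"
  shows "c = c'"
proof -
  \<comment> \<open>Normalized distance functions are bounded below, while a Busemann function falls
    to minus infinity along its ray; at time \<open>dist p x + 1\<close> it is already below the
    bound.\<close>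
  have no: "\<exists>y. horo_fun p (Inl x) y \<noteq> horo_fun p (Inr \<xi>) y" if \<xi>: "\<xi> \<in> gromov_boundary" for x \<xi>
  proof -
    obtain g where g: "g \<in> \<xi>" "g 0 = p" using ex_from_to[of "Inr \<xi>" p] \<xi> by auto
    have ray: "geodesic_ray g" using boundary_ray[OF \<xi> g(1)] .
    have "horo_fun p (Inr \<xi>) (g (dist p x + 1)) = - (dist p x + 1)"
      using horo_fun_Inr[OF \<xi> g(1), of p] busemann_ray[OF ray, of "dist p x + 1"] g(2) by simp
    moreover have "horo_fun p (Inl x) (g (dist p x + 1)) \<ge> - dist p x" by simp
    ultimately have "horo_fun p (Inl x) (g (dist p x + 1)) \<noteq> horo_fun p (Inr \<xi>) (g (dist p x + 1))"
      by linarith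
    then show ?thesis by blast
  qed
  have bd: "\<xi> = \<zeta>" if \<xi>: "\<xi> \<in> gromov_boundary" and \<zeta>: "\<zeta> \<in> gromov_boundary"
    and eq: "\<And>y. horo_fun p (Inr \<xi>) y = horo_fun p (Inr \<zeta>) y" for \<xi> \<zeta>
  proof -
    obtain g where g: "g \<in> \<xi>" "g 0 = p" using ex_from_to[of "Inr \<xi>" p] \<xi> by auto
    obtain h where h: "h \<in> \<zeta>" "h 0 = p" using ex_from_to[of "Inr \<zeta>" p] \<zeta> by auto
    have gray: "geodesic_ray g" and hray: "geodesic_ray h"
      using boundary_ray[OF \<xi> g(1)] boundary_ray[OF \<zeta> h(1)] .
    have "dist (g u) (h u) \<le> 2 * \<delta>" if "0 \<le> u" for u
    proof -
      \<comment> \<open>For a suitable \<open>s\<close>, equality of the Busemann functions makes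
        \<open>dist (g t) (h s)\<close> less than \<open>s - t + 1\<close>, so the Gromov product
        exceeds \<open>t - 1/2\<close>, hence \<open>u + \<delta>\<close>.\<close>
      define t where "t = u + \<delta> + 1"
      have "0 \<le> t" using that \<delta>_nonneg by (simp add: t_def)
      have "busemann h (g t) p = - t"
        using busemann_ray[OF gray \<open>0 \<le> t\<close>] eq[of "g t"] g(2)
          horo_fun_Inr[OF \<xi> g(1), of p] horo_fun_Inr[OF \<zeta> h(1), of p] by simp
      then have "\<forall>\<^sub>F s in at_top. dist (g t) (h s) - dist (h s) p < 1 - t"
        by (intro order_tendstoD(2)[OF busemann_tendsto[OF hray]]) simp
      then have "\<forall>\<^sub>F s in at_top. 0 \<le> s \<and> dist (g t) (h s) - dist (h s) p < 1 - t"
        by (intro eventually_conj eventually_ge_at_top)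
      then obtain s where s: "0 \<le> s" "dist (g t) (h s) - dist (h s) p < 1 - t"
        using eventually_happens'[OF trivial_limit_at_top_linorder] by blast
      have len: "dist p (h s) = s" "dist p (g t) = t"
        using geodesic_ray_dist[OF gray, of 0 t] geodesic_ray_dist[OF hray, of 0 s] \<open>0 \<le> t\<close> s(1) g(2) h(2)
        by auto
      have "dist (h u) (g u) \<le> 2 * \<delta>"
        by (rule fellow_travel[of p "g t" g "h s" h])
          (use geodesic_ray_segment[OF gray \<open>0 \<le> t\<close>] geodesic_ray_segment[OF hray s(1)] g(2) h(2) s len that
            in \<open>auto simp: t_def dist_commute\<close>)
      then show ?thesis by (simp add: dist_commute)
    qed
    then have "h \<in> \<xi>" by (rule boundary_mem[OF \<xi> g(1) hray])
    then show ?thesis using boundary_eqI[OF \<xi> \<zeta>] h(1) by blast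
  qed
  show ?thesis
  proof (cases c; cases c')
    fix x x' assume "c = Inl x" "c' = Inl x'"
    \<comment> \<open>Evaluation at \<open>x\<close> and at \<open>x'\<close> expresses
      \<open>dist x x'\<close> as the difference of the distances from \<open>p\<close>, once with
      each sign.\<close>
    then have "- dist p x = dist x x' - dist p x'" "dist x x' - dist p x = - dist p x'"
      using eq[of x] eq[of x'] by (simp_all add: dist_commute)
    then have "dist x x' = 0" by linarith
    then show ?thesis using \<open>c = Inl x\<close> \<open>c' = Inl x'\<close> by simp
  qed (use c eq no bd in \<open>fastforce+\<close>)
qed

end

section \<open>The comparison map\<close>

lemma openin_cont_fun_mod_const:
  "openin cont_fun_mod_const_topology V \<longleftrightarrow> V \<subseteq> topspace cont_fun_mod_const_topology \<and>
     openin cont_fun_topology {f. continuous_on UNIV f \<and> fun_class f \<in> V}"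
proof -
  have "openin cont_fun_topology {f \<in> {f. continuous_on UNIV f}. fun_class f \<in> V} \<longleftrightarrow>
      openin cont_fun_mod_const_topology V" if "V \<subseteq> topspace cont_fun_mod_const_topology"
    using quotient_map_fun_class that unfolding quotient_map_def topspace_cont_fun_topology by blast
  then show ?thesis using openin_subset[of cont_fun_mod_const_topology V] by auto
qed

lemma topspace_cont_fun_mod_const:
  "topspace cont_fun_mod_const_topology = fun_class ` {f. continuous_on UNIV f}"
  using quotient_map_fun_class unfolding quotient_map_def topspace_cont_fun_topology by blast

text \<open>A uniform bound \<open>m\<close> below \<open>\<epsilon>\<close>, instead of a strict inequality at each point, makes these sets
  open without an attained supremum.\<close>

definition class_nbhd :: "'a::metric_space \<Rightarrow> ('a \<Rightarrow> real) \<Rightarrow> 'a set \<Rightarrow> real \<Rightarrow> ('a \<Rightarrow> real) set set" where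
  "class_nbhd p f K \<epsilon> = fun_class ` {g. continuous_on UNIV g \<and>
     (\<exists>m<\<epsilon>. \<forall>y\<in>K. \<bar>(g y - g p) - (f y - f p)\<bar> \<le> m)}"

lemma fun_class_in_class_nbhd:
  assumes "continuous_on UNIV g"
  shows "fun_class g \<in> class_nbhd p f K \<epsilon> \<longleftrightarrow> (\<exists>m<\<epsilon>. \<forall>y\<in>K. \<bar>(g y - g p) - (f y - f p)\<bar> \<le> m)"
proof
  assume "fun_class g \<in> class_nbhd p f K \<epsilon>"
  then obtain g' m where "fun_class g = fun_class g'" "m < \<epsilon>"
    "\<forall>y\<in>K. \<bar>(g' y - g' p) - (f y - f p)\<bar> \<le> m"
    by (auto simp: class_nbhd_def)
  then show "\<exists>m<\<epsilon>. \<forall>y\<in>K. \<bar>(g y - g p) - (f y - f p)\<bar> \<le> m"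
    using fun_class_eq_iff[of g g' p] by auto
qed (use assms in \<open>auto simp: class_nbhd_def\<close>)

lemma openin_class_nbhd:
  assumes K: "compact K"
  shows "openin cont_fun_mod_const_topology (class_nbhd p f K \<epsilon>)"
proof -
  let ?C = "\<lambda>g m. \<forall>y\<in>K. \<bar>(g y - g p) - (f y - f p)\<bar> \<le> m"
  have "{g. continuous_on UNIV g \<and> fun_class g \<in> class_nbhd p f K \<epsilon>} =
      {g. continuous_on UNIV g \<and> (\<exists>m<\<epsilon>. ?C g m)}" (is "_ = ?U")
    using fun_class_in_class_nbhd by blast
  moreover have "openin cont_fun_topology ?U"
    unfolding openin_cont_fun_topology
  proof (intro conjI ballI)
    fix g assume "g \<in> ?U"
    then obtain m where m: "m < \<epsilon>" "?C g m" by blast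
    \<comment> \<open>A quarter of the slack at \<open>y\<close> and a quarter at \<open>p\<close>
      leave the uniform bound \<open>(\<epsilon> + m) / 2\<close>; hence \<open>p\<close> joins the
      compact set.\<close>
    have "{h. continuous_on UNIV h \<and> (\<forall>x\<in>insert p K. \<bar>h x - g x\<bar> < (\<epsilon> - m) / 4)} \<subseteq> ?U"
    proof
      fix h assume "h \<in> {h. continuous_on UNIV h \<and> (\<forall>x\<in>insert p K. \<bar>h x - g x\<bar> < (\<epsilon> - m) / 4)}"
      then have h: "continuous_on UNIV h" "\<bar>h p - g p\<bar> < (\<epsilon> - m) / 4"
        "\<forall>y\<in>K. \<bar>h y - g y\<bar> < (\<epsilon> - m) / 4" by auto
      have "?C h ((\<epsilon> + m) / 2)"
      proof
        fix y assume y: "y \<in> K"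
        have "\<bar>h y - g y\<bar> < (\<epsilon> - m) / 4" "\<bar>(g y - g p) - (f y - f p)\<bar> \<le> m" using h(3) m(2) y by auto
        then show "\<bar>(h y - h p) - (f y - f p)\<bar> \<le> (\<epsilon> + m) / 2" using h(2) by argo
      qed
      then show "h \<in> ?U" using h(1) m(1) by (auto intro!: exI[of _ "(\<epsilon> + m) / 2"])
    qed
    then show "\<exists>K \<epsilon>'. compact K \<and> \<epsilon>' > 0 \<and> {h. continuous_on UNIV h \<and> (\<forall>x\<in>K. \<bar>h x - g x\<bar> < \<epsilon>')} \<subseteq> ?U"
      using K m(1) by (intro exI[of _ "insert p K"] exI[of _ "(\<epsilon> - m) / 4"]) auto
  qed blast
  ultimately show ?thesis
    unfolding openin_cont_fun_mod_const topspace_cont_fun_mod_const by (auto simp: class_nbhd_def)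
qed

text \<open>Pointwise convergence of 1-Lipschitz representatives is uniform on compact sets, and
  this passes to the quotient.\<close>

lemma limitin_fun_class:
  assumes lip: "\<And>n x y. dist (f n x) (f n y) \<le> dist x y" and lim: "\<And>y. (\<lambda>n. f n y) \<longlonglongrightarrow> h y"
    and h: "continuous_on UNIV h"
  shows "limitin cont_fun_mod_const_topology (\<lambda>n. fun_class (f n)) (fun_class h) sequentially"
  unfolding limitin_def
proof (intro conjI allI impI)
  show "fun_class h \<in> topspace cont_fun_mod_const_topology"
    using h by (auto simp: topspace_cont_fun_mod_const)
  fix V assume V: "openin cont_fun_mod_const_topology V \<and> fun_class h \<in> V"
  then have "openin cont_fun_topology {f. continuous_on UNIV f \<and> fun_class f \<in> V}"
    by (simp add: openin_cont_fun_mod_const)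
  then obtain K \<epsilon> where K: "compact K" "\<epsilon> > 0"
    "{g. continuous_on UNIV g \<and> (\<forall>x\<in>K. \<bar>g x - h x\<bar> < \<epsilon>)} \<subseteq> {f. continuous_on UNIV f \<and> fun_class f \<in> V}"
    unfolding openin_cont_fun_topology using h V by blast
  have "uniform_limit K f h sequentially"
    by (rule uniform_limit_lipschitz[OF lip lim K(1)])
  then have "\<forall>\<^sub>F n in sequentially. \<forall>x\<in>K. dist (f n x) (h x) < \<epsilon>"
    using K(2) by (rule uniform_limitD)
  then show "\<forall>\<^sub>F n in sequentially. fun_class (f n) \<in> V"
  proof eventually_elim
    case (elim n)
    have "continuous_on UNIV (f n)"
      by (rule lipschitz_on_continuous_on[of 1]) (use lip in \<open>auto simp: lipschitz_on_def\<close>)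
    then show ?case using K(3) elim by (auto simp: dist_real_def)
  qed
qed

lemma closedin_gromov_compactification:
  "closedin (gromov_compactification p) C \<longleftrightarrow> C \<subseteq> gromov_carrier \<and> gromov_closed p C"
  unfolding closedin_def openin_gromov_compactification topspace_gromov_compactification
  by (metis Diff_subset double_diff subset_refl)

section \<open>Continuity, closedness and image of the comparison map\<close>

context approaching_space
begin

lemma interior_limitin:
  assumes "y \<longlonglongrightarrow> (x::'a)"
  shows "limitin cont_fun_mod_const_topology (\<lambda>n. gromov_to_horo (Inl (y n))) (gromov_to_horo (Inl x)) sequentially"
  unfolding gromov_to_horo.simps
proof (rule limitin_fun_class)
  fix n u v show "dist (dist u (y n)) (dist v (y n)) \<le> dist u v"
    by (simp add: dist_real_def abs_le_iff) metric
next
  show "(\<lambda>n. dist u (y n)) \<longlonglongrightarrow> dist u x" for u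
    by (intro tendsto_dist tendsto_const assms)
qed (intro continuous_intros)

lemma boundary_limitin:
  fixes p :: 'a
  assumes conv: "gromov_converges p c \<xi>" and \<xi>: "\<xi> \<in> gromov_boundary"
    and c: "\<And>n. c n \<in> gromov_carrier"
  shows "limitin cont_fun_mod_const_topology (\<lambda>n. gromov_to_horo (c n)) (gromov_to_horo (Inr \<xi>)) sequentially"
proof -
  have "limitin cont_fun_mod_const_topology (\<lambda>n. fun_class (horo_fun p (c n)))
      (fun_class (horo_fun p (Inr \<xi>))) sequentially"
    by (rule limitin_fun_class[OF horo_fun_lipschitz[OF c] horo_fun_tendsto[OF conv \<xi> c]
          horo_fun_continuous]) (simp add: \<xi>)
  then show ?thesis using c \<xi> by (simp add: gromov_to_horo_eq[of _ p] del: gromov_to_horo.simps)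
qed

text \<open>A subsequence of \<open>c\<close> converges in \<open>A\<close> by sequential
  compactness. Normalization at \<open>p\<close> makes the representatives converge as functions,
  and uniqueness of limits identifies \<open>\<phi>\<close>.\<close>

lemma gromov_to_horo_limit_closed:
  fixes p :: 'a
  assumes A: "A \<subseteq> gromov_carrier" "gromov_closed p A" and c: "\<And>n. c n \<in> A"
    and lim: "\<And>y. (\<lambda>n. horo_fun p (c n) y) \<longlonglongrightarrow> \<phi> y"
  shows "\<exists>w\<in>A. \<phi> = horo_fun p w"
proof -
  have car: "c n \<in> gromov_carrier" for n using A(1) c by blast
  show ?thesis
  proof (rule gromov_carrier_seq_compact[OF car, where p = p])
    fix r :: "nat \<Rightarrow> nat" and x y
    assume r: "strict_mono r" and cy: "\<And>n. c (r n) = Inl (y n)" and yx: "y \<longlonglongrightarrow> x"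
    have "y n \<in> Inl -` A" for n using c[of "r n"] cy[of n] by simp
    moreover have "closed (Inl -` A)" using A(2) by (simp add: gromov_closed_def)
    ultimately have "Inl x \<in> A" using yx closed_sequentially by blast
    moreover have "\<phi> u = horo_fun p (Inl x) u" for u
    proof (rule LIMSEQ_unique)
      show "(\<lambda>n. horo_fun p (c (r n)) u) \<longlonglongrightarrow> \<phi> u"
        using LIMSEQ_subseq_LIMSEQ[OF lim r] by (simp add: o_def)
      show "(\<lambda>n. horo_fun p (c (r n)) u) \<longlonglongrightarrow> horo_fun p (Inl x) u"
        unfolding cy horo_fun_Inl by (intro tendsto_intros yx)
    qed
    ultimately show ?thesis by blast
  next
    fix r :: "nat \<Rightarrow> nat" and \<xi>
    assume r: "strict_mono r" and \<xi>: "\<xi> \<in> gromov_boundary" and conv: "gromov_converges p (c \<circ> r) \<xi>"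
    have "range (c \<circ> r) \<subseteq> A" using c by auto
    then have "Inr \<xi> \<in> A" using A(2) \<xi> conv unfolding gromov_closed_def by blast
    moreover have "\<phi> u = horo_fun p (Inr \<xi>) u" for u
    proof (rule LIMSEQ_unique)
      show "(\<lambda>n. horo_fun p ((c \<circ> r) n) u) \<longlonglongrightarrow> \<phi> u"
        using LIMSEQ_subseq_LIMSEQ[OF lim r] by (simp add: o_def)
      show "(\<lambda>n. horo_fun p ((c \<circ> r) n) u) \<longlonglongrightarrow> horo_fun p (Inr \<xi>) u"
        by (rule horo_fun_tendsto[OF conv \<xi>]) (use car in simp)
    qed
    ultimately show ?thesis by blast
  qed
qed

text \<open>For a class in the closure, the sets \<open>class_nbhd\<close> with radius
  \<open>n\<close> and tolerance 1/(n+1) select a sequence in \<open>A\<close>; these sets are open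
  because closed balls are compact. As the balls exhaust the space, the representatives converge
  pointwise.\<close>

lemma closedin_gromov_to_horo_image:
  fixes p :: 'a
  assumes A: "A \<subseteq> gromov_carrier" "gromov_closed p A"
  shows "closedin cont_fun_mod_const_topology (gromov_to_horo ` A)"
proof -
  have "z \<in> gromov_to_horo ` A"
    if z: "z \<in> cont_fun_mod_const_topology closure_of (gromov_to_horo ` A)" for z
  proof -
    have meets: "\<exists>y\<in>gromov_to_horo ` A. y \<in> T" if "z \<in> T" "openin cont_fun_mod_const_topology T" for T
      using z that unfolding in_closure_of by blast
    obtain f where f: "continuous_on UNIV f" "z = fun_class f"
      using z unfolding in_closure_of topspace_cont_fun_mod_const by blast
    have "\<exists>c\<in>A. \<forall>y\<in>cball p (real n). \<bar>horo_fun p c y - (f y - f p)\<bar> < inverse (real (Suc n))" for n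
    proof -
      have "z \<in> class_nbhd p f (cball p (real n)) (inverse (real (Suc n)))"
        unfolding f(2) fun_class_in_class_nbhd[OF f(1)] by (rule exI[of _ 0]) simp
      then obtain c where c: "c \<in> A" "gromov_to_horo c \<in> class_nbhd p f (cball p (real n)) (inverse (real (Suc n)))"
        using meets openin_class_nbhd[OF compact_cball] by (metis imageE)
      then have car: "c \<in> gromov_carrier" using A(1) by blast
      then have "fun_class (horo_fun p c) \<in> class_nbhd p f (cball p (real n)) (inverse (real (Suc n)))"
        using c(2) gromov_to_horo_eq[OF car] by metis
      then obtain m where "m < inverse (real (Suc n))"
        "\<forall>y\<in>cball p (real n). \<bar>(horo_fun p c y - horo_fun p c p) - (f y - f p)\<bar> \<le> m"
        unfolding fun_class_in_class_nbhd[OF horo_fun_continuous[OF car]] by blast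
      then show ?thesis
        using c(1) horo_fun_base[OF car, of p] by (intro bexI[of _ c]) auto
    qed
    then obtain c where c: "\<And>n. c n \<in> A"
      "\<And>n y. y \<in> cball p (real n) \<Longrightarrow> \<bar>horo_fun p (c n) y - (f y - f p)\<bar> < inverse (real (Suc n))"
      by metis
    have lim: "(\<lambda>n. horo_fun p (c n) y) \<longlonglongrightarrow> f y - f p" for y
    proof (rule LIM_zero_cancel, rule Lim_null_comparison[OF _ LIMSEQ_inverse_real_of_nat])
      show "\<forall>\<^sub>F n in sequentially. norm (horo_fun p (c n) y - (f y - f p)) \<le> inverse (real (Suc n))"
        using eventually_ge_at_top[of "nat \<lceil>dist p y\<rceil>"]
      proof eventually_elim
        case (elim n)
        then have "y \<in> cball p (real n)" by (simp add: nat_le_iff ceiling_le_iff)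
        then show ?case using c(2) less_imp_le by fastforce
      qed
    qed
    obtain w where w: "w \<in> A" "(\<lambda>y. f y - f p) = horo_fun p w"
      using gromov_to_horo_limit_closed[OF A c(1) lim] by blast
    have car: "w \<in> gromov_carrier" using A(1) w(1) by blast
    have "z = fun_class (horo_fun p w)"
      unfolding f(2) fun_class_eq_iff[of _ _ p] w(2)[symmetric] by simp
    then show ?thesis using gromov_to_horo_eq[OF car, of p] w(1) by blast
  qed
  moreover have "gromov_to_horo ` A \<subseteq> topspace cont_fun_mod_const_topology"
    using A(1) gromov_to_horo_eq[of _ p] horo_fun_continuous[of _ p]
    unfolding topspace_cont_fun_mod_const by blast
  ultimately show ?thesis
    by (simp add: subsetI flip: closure_of_subset_eq)
qed

text \<open>The image is closed and contains the embedded points, hence their closure; conversely,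
  boundary points are sent to limits along rays.\<close>

lemma gromov_to_horo_image:
  "gromov_to_horo ` (gromov_carrier :: ('a + (real \<Rightarrow> 'a) set) set) =
     cont_fun_mod_const_topology closure_of range horo_embedding"
proof
  have range: "range horo_embedding \<subseteq> gromov_to_horo ` (gromov_carrier :: ('a + (real \<Rightarrow> 'a) set) set)"
  proof
    fix z :: "('a \<Rightarrow> real) set" assume "z \<in> range horo_embedding"
    then obtain x where "z = gromov_to_horo (Inl x)" by (auto simp: horo_embedding_def)
    then show "z \<in> gromov_to_horo ` gromov_carrier"
      using Inl_in_gromov_carrier by (rule image_eqI)
  qed
  then show "cont_fun_mod_const_topology closure_of range horo_embedding \<subseteq>
      gromov_to_horo ` (gromov_carrier :: ('a + (real \<Rightarrow> 'a) set) set)"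
    using closedin_gromov_to_horo_image[OF subset_refl gromov_closed_carrier]
    by (rule closure_of_minimal)
  have emb: "gromov_to_horo (Inl x) \<in> cont_fun_mod_const_topology closure_of range horo_embedding" for x :: 'a
  proof -
    have "range horo_embedding \<subseteq> topspace (cont_fun_mod_const_topology :: ('a \<Rightarrow> real) set topology)"
      using range closedin_subset[OF closedin_gromov_to_horo_image[OF subset_refl gromov_closed_carrier]]
      by blast
    from closure_of_subset[OF this] show ?thesis by (auto simp: horo_embedding_def)
  qed
  show "gromov_to_horo ` gromov_carrier \<subseteq> cont_fun_mod_const_topology closure_of range (horo_embedding :: 'a \<Rightarrow> _)"
  proof (rule image_subsetI)
    fix c :: "'a + (real \<Rightarrow> 'a) set" assume c: "c \<in> gromov_carrier"
    show "gromov_to_horo c \<in> cont_fun_mod_const_topology closure_of range horo_embedding"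
    proof (cases c)
      case (Inr \<xi>)
      then obtain \<gamma> where \<gamma>: "geodesic_ray \<gamma>" "\<xi> = ray_class \<gamma>" using c by (auto simp: gromov_boundary_def)
      have lim: "limitin cont_fun_mod_const_topology (\<lambda>n. gromov_to_horo (Inl (\<gamma> (real n))))
          (gromov_to_horo (Inr \<xi>)) sequentially"
        unfolding \<gamma>(2)
        by (rule boundary_limitin[OF ray_points_converge[OF \<gamma>(1)] ray_class_in_boundary[OF \<gamma>(1)]]) simp
      show ?thesis
        unfolding Inr
        by (rule limitin_closedin[OF lim closedin_closure_of])
          (use emb in \<open>auto simp del: gromov_to_horo.simps\<close>)
    qed (use emb in blast)
  qed
qed

text \<open>Closedness in the Gromov compactification is tested on metrically convergent sequences
  and on those converging to boundary points, so sequential continuity suffices.\<close>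

lemma continuous_map_gromov_to_horo:
  fixes p :: 'a
  shows "continuous_map (gromov_compactification p) cont_fun_mod_const_topology gromov_to_horo"
  unfolding continuous_map_closedin topspace_gromov_compactification
proof (intro conjI allI impI)
  show "gromov_to_horo \<in> (gromov_carrier :: ('a + (real \<Rightarrow> 'a) set) set) \<rightarrow> topspace cont_fun_mod_const_topology"
    using closedin_subset[OF closedin_gromov_to_horo_image[OF subset_refl gromov_closed_carrier]]
    by blast
  fix C :: "('a \<Rightarrow> real) set set" assume C: "closedin cont_fun_mod_const_topology C"
  have "closed (Inl -` {c \<in> gromov_carrier. gromov_to_horo c \<in> C})"
    unfolding closed_sequential_limits
  proof (intro allI impI, elim conjE)
    fix y x assume "\<forall>n. y n \<in> Inl -` {c \<in> gromov_carrier. gromov_to_horo c \<in> C}" "y \<longlonglongrightarrow> x"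
    then show "x \<in> Inl -` {c \<in> gromov_carrier. gromov_to_horo c \<in> C}"
      using limitin_closedin[OF interior_limitin C] by (simp del: gromov_to_horo.simps)
  qed
  moreover have "gromov_to_horo (Inr \<xi>) \<in> C"
    if "\<xi> \<in> gromov_boundary" "range c \<subseteq> {c \<in> gromov_carrier. gromov_to_horo c \<in> C}"
      "gromov_converges p c \<xi>" for c \<xi>
    by (rule limitin_closedin[OF boundary_limitin[OF that(3,1)] C])
      (use that(2) in \<open>auto simp: image_subset_iff simp del: gromov_to_horo.simps\<close>)
  ultimately show "closedin (gromov_compactification p) {c \<in> gromov_carrier. gromov_to_horo c \<in> C}"
    unfolding closedin_gromov_compactification gromov_closed_def
    by (auto simp del: gromov_to_horo.simps)
qed

text \<open>A continuous closed bijection. Injectivity passes from functions to classes because the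
  representatives vanish at \<open>p\<close>.\<close>

lemma homeomorphic_map_gromov_to_horo:
  fixes p :: 'a
  shows "homeomorphic_map (gromov_compactification p) horofunction_compactification gromov_to_horo"
proof (rule bijective_closed_imp_homeomorphic_map)
  show "continuous_map (gromov_compactification p) horofunction_compactification gromov_to_horo"
    unfolding horofunction_compactification_def continuous_map_in_subtopology
      topspace_gromov_compactification
    using continuous_map_gromov_to_horo gromov_to_horo_image by blast
  show "closed_map (gromov_compactification p) horofunction_compactification gromov_to_horo"
    unfolding closed_map_def closedin_gromov_compactification
  proof (intro allI impI)
    fix A :: "('a + (real \<Rightarrow> 'a) set) set" assume "A \<subseteq> gromov_carrier \<and> gromov_closed p A"
    then have "closedin cont_fun_mod_const_topology (gromov_to_horo ` A)"
      "gromov_to_horo ` A \<subseteq> cont_fun_mod_const_topology closure_of range horo_embedding"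
      using closedin_gromov_to_horo_image gromov_to_horo_image by blast+
    then show "closedin horofunction_compactification (gromov_to_horo ` A)"
      unfolding horofunction_compactification_def by (rule closedin_subset_topspace)
  qed
  show "gromov_to_horo ` topspace (gromov_compactification p) = topspace horofunction_compactification"
    unfolding horofunction_compactification_def topspace_gromov_compactification topspace_subtopology
    by (simp add: gromov_to_horo_image closure_of_subset_topspace Int_absorb1)
  show "inj_on gromov_to_horo (topspace (gromov_compactification p))"
    unfolding topspace_gromov_compactification
  proof (rule inj_onI)
    fix c c' :: "'a + (real \<Rightarrow> 'a) set"
    assume c: "c \<in> gromov_carrier" "c' \<in> gromov_carrier" and "gromov_to_horo c = gromov_to_horo c'"
    then have "fun_class (horo_fun p c) = fun_class (horo_fun p c')"
      by (simp only: gromov_to_horo_eq[of _ p])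
    then have "horo_fun p c y = horo_fun p c' y" for y
      using horo_fun_base[OF c(1), of p] horo_fun_base[OF c(2), of p]
      unfolding fun_class_eq_iff[of _ _ p] by simp
    then show "c = c'" by (rule horo_fun_inj[OF c])
  qed
qed

text \<open>The choices made in the definition are immaterial: the representative may be normalized
  at any \<open>y\<close> and computed from any ray of the class.\<close>

lemma gromov_to_horo_ray_class:
  fixes y :: 'a
  assumes \<gamma>: "geodesic_ray \<gamma>"
  shows "gromov_to_horo (Inr (ray_class \<gamma>)) = fun_class (\<lambda>x. busemann \<gamma> x y)"
proof -
  have "gromov_to_horo (Inr (ray_class \<gamma>)) = fun_class (horo_fun y (Inr (ray_class \<gamma>)))"
    by (rule gromov_to_horo_eq) (simp add: ray_class_in_boundary \<gamma>)
  then show ?thesis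
    using horo_fun_Inr[OF ray_class_in_boundary[OF \<gamma>] ray_class_self[OF \<gamma>], of y] by presburger
qed

end

theorem theorem3p11:
  fixes F :: "(real \<Rightarrow> 'a::metric_space) set" and p :: 'a
  assumes "proper_space TYPE('a)"
    and "geodesic_space TYPE('a)"
    and "gromov_hyperbolic_space TYPE('a)"
    and "F \<subseteq> {\<gamma>. geodesic_ray \<gamma>}"
    and "weak_approaching_geodesics F"
  shows "(\<forall>\<gamma>::real \<Rightarrow> 'a. geodesic_ray \<gamma> \<longrightarrow>
           (\<forall>y. gromov_to_horo (Inr (ray_class \<gamma>)) = fun_class (\<lambda>x. busemann \<gamma> x y)))
       \<and> homeomorphic_map (gromov_compactification p) horofunction_compactification gromov_to_horo
       \<and> topologically_equivalent (gromov_compactification p) Inl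
           horofunction_compactification horo_embedding"
proof -
  obtain \<delta> where \<delta>: "\<forall>(x::'a) y z \<alpha> \<beta> \<gamma>.
      geodesic_segment x y \<alpha> \<and> geodesic_segment y z \<beta> \<and> geodesic_segment x z \<gamma> \<longrightarrow>
      (\<forall>s\<in>{0..dist x y}. \<exists>q \<in> \<beta> ` {0..dist y z} \<union> \<gamma> ` {0..dist x z}. dist (\<alpha> s) q \<le> \<delta>)"
    using assms(3) unfolding gromov_hyperbolic_space_def by (elim exE)
  \<comment> \<open>The slimness constant comes without a sign; \<open>max 0 \<delta>\<close> is
    nonnegative and only weakens the bound.\<close>
  interpret approaching_space "max 0 \<delta>" "TYPE('a)" F
  proof
    fix x y z :: 'a and \<alpha> \<beta> \<gamma> s
    assume *: "geodesic_segment x y \<alpha>" "geodesic_segment y z \<beta>" "geodesic_segment x z \<gamma>"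
      "s \<in> {0..dist x y}"
    obtain q where "q \<in> \<beta> ` {0..dist y z} \<union> \<gamma> ` {0..dist x z}" "dist (\<alpha> s) q \<le> \<delta>"
      using \<delta>[rule_format, OF conjI[OF *(1) conjI[OF *(2,3)]] *(4)] by blast
    then show "\<exists>q\<in>\<beta> ` {0..dist y z} \<union> \<gamma> ` {0..dist x z}. dist (\<alpha> s) q \<le> max 0 \<delta>"
      by (intro bexI[of _ q]) auto
  qed (use assms in \<open>auto simp: proper_space_def geodesic_space_def\<close>)
  have "topologically_equivalent (gromov_compactification p) Inl horofunction_compactification horo_embedding"
    unfolding topologically_equivalent_def
    using homeomorphic_map_gromov_to_horo[of p]
    by (intro exI[of _ gromov_to_horo] conjI allI) (simp_all add: horo_embedding_def)
  then show ?thesis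
    using gromov_to_horo_ray_class homeomorphic_map_gromov_to_horo by (intro conjI allI impI)
qed

end
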